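(* Let $n\ge 3$ and let $K_n$ be the complete graph on $\{x_1,\ldots,x_n\}$. The Gorenstein polytopes in $\mathbb{R}^n$ of the form $\operatorname{conv}(\mathcal{D}(K_n,\mathfrak{c}))$ with $\mathfrak{c}\in(\mathbb{Z}_{>0})^n$ are exactly the following: (i) $\mathcal{Q}_n'+(1,\ldots,1)$; (ii) $\mathcal{Q}_n$, when $n$ is even; (iii) $\mathcal{P}_3$, when $n=3$.
   Context: Let $n\ge 3$ and let $G$ be a finite graph on the vertex set $V(G)=\{x_1,\ldots,x_n\}$ with no loops, no multiple edges and no isolated vertices. Let $S=K[x_1,\ldots,x_n]$ be the polynomial ring over a field $K$ and let $I(G)\subset S$ be the edge ideal, generated by the monomials $x_ix_j$ with $\{x_i,x_j\}\in E(G)$. For $\mathfrak{c}=(c_1,\ldots,c_n)\in(\mathbb{Z}_{>0})^n$ and an integer $q\ge1$, $(I(G)^q)_{\mathfrak{c}}$ is the ideal generated by the monomials $x_1^{a_1}\cdots x_n^{a_n}\in I(G)^q$ with $a_i\le c_i$ for all $i$. Let $\delta_{\mathfrak{c}}(I(G))$ be the largest $q$ with $(I(G)^q)_{\mathfrak{c}}\ne(0)$, and let $\mathcal{B}(G,\mathfrak{c})$ be the minimal set of monomial generators of $(I(G)^{\delta_{\mathfrak{c}}(I(G))})_{\mathfrak{c}}$. Let $\mathcal{D}(G,\mathfrak{c})$ be the set of vectors $(a_1,\ldots,a_n)\in\mathbb{Z}_{\ge0}^n$ such that $x_1^{a_1}\cdots x_n^{a_n}$ divides some $u\in\mathcal{B}(G,\mathfrak{c})$,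 and let $\operatorname{conv}(\mathcal{D}(G,\mathfrak{c}))\subset\mathbb{R}^n$ be its convex hull. A lattice polytope (all vertices in $\mathbb{Z}^n$) $\mathcal{P}\subset\mathbb{R}^n$ of dimension $n$ is reflexive if the origin lies in its interior and its dual $\mathcal{P}^\vee=\{x\in\mathbb{R}^n:\sum_i x_iy_i\le1\ \forall y\in\mathcal{P}\}$ is a lattice polytope. A lattice polytope $\mathcal{P}\subset\mathbb{R}^n$ of dimension $n$ is Gorenstein if there are an integer $\delta>0$ and $\mathbf{a}\in\mathbb{Z}^n$ such that $\delta\mathcal{P}-\mathbf{a}$ is reflexive. $\mathcal{Q}_n=[0,1]^n\subset\mathbb{R}^n$ is the standard unit cube and $\mathcal{Q}_n'=2\mathcal{Q}_n-(1,\ldots,1)=[-1,1]^n$, so $\mathcal{Q}_n'+(1,\ldots,1)=[0,2]^n$. $\mathcal{P}_3\subset\mathbb{R}^3$ is the polytope defined by $0\le x_i\le1$ for $1\le i\le3$ and $x_1+x_2+x_3\le2$. *)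

theory Defs
  imports "HOL-Analysis.Analysis" "HOL-Library.Poly_Mapping"
begin

text \<open>
  The variables are indexed by a finite type \<open>'n\<close>, so that \<open>n\<close> is \<open>CARD('n)\<close> and a variable is
  identified with its index. The polynomial ring \<open>K[x\<^sub>i | i :: 'n]\<close> is the monoid algebra of
  \<open>'n \<Rightarrow>\<^sub>0 nat\<close> over the field \<open>'k\<close>, with the convolution product of \<open>Poly_Mapping\<close>.
\<close>

type_synonym ('n, 'k) mpoly = "('n \<Rightarrow>\<^sub>0 nat) \<Rightarrow>\<^sub>0 'k"

definition mono_of :: "('n \<Rightarrow>\<^sub>0 nat) \<Rightarrow> ('n, 'k::field) mpoly" where
  "mono_of a = Poly_Mapping.single a 1"

definition Var :: "'n \<Rightarrow> ('n, 'k::field) mpoly" where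
  "Var i = mono_of (Poly_Mapping.single i 1)"

text \<open>The ideal generated by a set is its span in the ring regarded as a module over itself.\<close>

definition ideal_gen :: "'a::comm_ring_1 set \<Rightarrow> 'a set" where
  "ideal_gen A = module.span (*) A"

definition ideal_power :: "'a::comm_ring_1 set \<Rightarrow> nat \<Rightarrow> 'a set" where
  "ideal_power I q = ideal_gen {\<Prod>j<q. f j | f. \<forall>j<q. f j \<in> I}"

text \<open>A simple graph on the vertex set \<open>UNIV :: 'n set\<close> is given by its set of two-element edges.\<close>

definition complete_graph :: "'n set set" where
  "complete_graph = {{i, j} | i j. i \<noteq> j}"

definition edge_ideal :: "'n set set \<Rightarrow> ('n, 'k::field) mpoly set" where
  "edge_ideal E = ideal_gen {Var i * Var j | i j. {i, j} \<in> E}"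

definition bounded_part :: "('n \<Rightarrow> nat) \<Rightarrow> ('n, 'k::field) mpoly set \<Rightarrow> ('n, 'k) mpoly set" where
  "bounded_part c J = ideal_gen {mono_of a | a. mono_of a \<in> J \<and> (\<forall>i. Poly_Mapping.lookup a i \<le> c i)}"

definition delta :: "('n \<Rightarrow> nat) \<Rightarrow> ('n, 'k::field) mpoly set \<Rightarrow> nat" where
  "delta c I = (GREATEST q. 1 \<le> q \<and> bounded_part c (ideal_power I q) \<noteq> {0})"

text \<open>
  A monomial ideal has exactly one irredundant generating set consisting of monomials, so the
  definite description below is proper for such an ideal.
\<close>

definition min_mono_gens :: "('n, 'k::field) mpoly set \<Rightarrow> ('n, 'k) mpoly set" where
  "min_mono_gens J = (THE B. B \<subseteq> range mono_of \<and> ideal_gen B = J \<and>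
     (\<forall>B'. B' \<subset> B \<longrightarrow> ideal_gen B' \<noteq> J))"

definition base_set :: "'n set set \<Rightarrow> ('n \<Rightarrow> nat) \<Rightarrow> ('n, 'k::field) mpoly set" where
  "base_set E c =
     min_mono_gens (bounded_part c (ideal_power (edge_ideal E) (delta c (edge_ideal E :: ('n, 'k) mpoly set))))"

text \<open>The field occurs only through its type, which is passed as an \<open>itself\<close> argument.\<close>

definition D_set :: "'k::field itself \<Rightarrow> 'n set set \<Rightarrow> ('n \<Rightarrow> nat) \<Rightarrow> ('n \<Rightarrow>\<^sub>0 nat) set" where
  "D_set K E c = {a. \<exists>u \<in> (base_set E c :: ('n, 'k) mpoly set). mono_of a dvd u}"

definition real_vec :: "('n::finite \<Rightarrow>\<^sub>0 nat) \<Rightarrow> real ^ 'n" where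
  "real_vec a = (\<chi> i. real (Poly_Mapping.lookup a i))"

definition conv_D :: "'k::field itself \<Rightarrow> 'n::finite set set \<Rightarrow> ('n \<Rightarrow> nat) \<Rightarrow> (real ^ 'n) set" where
  "conv_D K E c = convex hull (real_vec ` D_set K E c)"

definition lattice_polytope :: "(real ^ 'n) set \<Rightarrow> bool" where
  "lattice_polytope P \<longleftrightarrow> polytope P \<and> (\<forall>v. v extreme_point_of P \<longrightarrow> (\<forall>i. v $ i \<in> \<int>))"

definition dual_polytope :: "(real ^ 'n) set \<Rightarrow> (real ^ 'n) set" where
  "dual_polytope P = {x. \<forall>y\<in>P. (\<Sum>i\<in>UNIV. x $ i * y $ i) \<le> 1}"

definition reflexive_polytope :: "(real ^ 'n) set \<Rightarrow> bool" where
  "reflexive_polytope P \<longleftrightarrow> lattice_polytope P \<and> aff_dim P = int CARD('n) \<and>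
     0 \<in> interior P \<and> lattice_polytope (dual_polytope P)"

definition gorenstein_polytope :: "(real ^ 'n) set \<Rightarrow> bool" where
  "gorenstein_polytope P \<longleftrightarrow> lattice_polytope P \<and> aff_dim P = int CARD('n) \<and>
     (\<exists>(d::int) (a :: int ^ 'n). d > 0 \<and>
        reflexive_polytope ((\<lambda>x. of_int d *\<^sub>R x - (\<chi> i. of_int (a $ i))) ` P))"

text \<open>In \<open>real ^ 'n\<close>, the constant \<open>1\<close> is the all-ones vector.\<close>

definition cube_Q :: "(real ^ 'n) set" where
  "cube_Q = {x. \<forall>i. 0 \<le> x $ i \<and> x $ i \<le> 1}"

definition cube_Q' :: "(real ^ 'n) set" where
  "cube_Q' = (\<lambda>x. 2 *\<^sub>R x - 1) ` cube_Q"

text \<open>This is the polytope \<open>\<P>\<^sub>3\<close> when \<open>CARD('n) = 3\<close>; it is not meant to be used otherwise.\<close>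

definition P3 :: "(real ^ 'n) set" where
  "P3 = {x. (\<forall>i. 0 \<le> x $ i \<and> x $ i \<le> 1) \<and> (\<Sum>i\<in>UNIV. x $ i) \<le> 2}"

end

theory Submission
  imports Defs
begin

text \<open>
  The products of \<open>q\<close> edges of the complete graph are the monomials of degree \<open>2q\<close> all of whose
  exponents are at most \<open>q\<close>. Hence a bound \<open>c\<^sub>i\<close> exceeding the sum of the other bounds may be lowered
  to that sum, and one may assume \<open>2 c\<^sub>i \<le> C\<close> for all \<open>i\<close>, where \<open>C\<close> is the sum of the bounds. In
  that case the polytope is the box with sides \<open>c\<^sub>i\<close>, cut by \<open>x\<^sub>1 + \<dots> + x\<^sub>n \<le> C - 1\<close> if \<open>C\<close> is odd.
  A facet of a reflexive polytope with primitive normal vector has lattice distance 1 from the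
  origin. If \<open>\<delta>P - a\<close> is reflexive, the facets \<open>x\<^sub>i = 0\<close> and \<open>x\<^sub>i = c\<^sub>i\<close> thus give \<open>a\<^sub>i = 1\<close> and
  \<open>\<delta> c\<^sub>i = 2\<close>, so that all \<open>c\<^sub>i\<close> are 1 or all are 2, and for odd \<open>C\<close> the last facet gives
  \<open>\<delta>(C - 1) - n = 1\<close>, which leaves only \<open>n = 3\<close>.
\<close>

section \<open>Truncated boxes\<close>

text \<open>Every polytope in the classification has this form. Once \<open>s\<close> is at least
  the sum of \<open>u\<close> the cut is vacuous and only the box remains.\<close>

definition trunc_box :: "('n::finite \<Rightarrow> nat) \<Rightarrow> nat \<Rightarrow> (real ^ 'n) set" where
  "trunc_box u s = {x. (\<forall>i. 0 \<le> x $ i \<and> x $ i \<le> real (u i)) \<and> (\<Sum>i\<in>UNIV. x $ i) \<le> real s}"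

lemma inner_vec_alt: "x \<bullet> y = (\<Sum>i\<in>UNIV. x $ i * y $ i)" for x y :: "real ^ 'n"
  by (simp add: inner_vec_def)

lemma sum_axis [simp]: "(\<Sum>i\<in>UNIV. axis j t $ i) = t" for j :: "'n::finite" and t :: real
  by (simp add: axis_def)

lemma trunc_box_eq_Int:
  "trunc_box u s = cbox 0 (\<chi> i. real (u i)) \<inter> {x. 1 \<bullet> x \<le> real s}"
  by (auto simp: trunc_box_def mem_box_cart inner_vec_alt)

lemma polytope_trunc_box: "polytope (trunc_box u s)"
  unfolding trunc_box_eq_Int
  by (intro polytope_Int_polyhedron polytope_interval polyhedron_halfspace_le)

text \<open>Such an \<open>x\<close> is the midpoint of two distinct points of
  \<open>S\<close>.\<close>

lemma not_extreme_point_of_perturbation: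
  fixes x v :: "'a::real_vector"
  assumes "x + v \<in> S" "x - v \<in> S" "v \<noteq> 0"
  shows "\<not> x extreme_point_of S"
proof
  assume "x extreme_point_of S"
  then have "x \<notin> open_segment (x + v) (x - v)"
    using assms(1,2) by (simp add: extreme_point_of_def)
  moreover have "midpoint (x + v) (x - v) = x"
    by (simp add: midpoint_def scaleR_2[symmetric])
  moreover have "x + v \<noteq> x - v"
  proof
    assume "x + v = x - v"
    then have "v + v = 0" by (simp add: algebra_simps)
    then show False using \<open>v \<noteq> 0\<close> by (simp add: scaleR_2[symmetric])
  qed
  ultimately show False using midpoint_in_open_segment by metis
qed

text \<open>A point with a non-integral coordinate \<open>i\<close> can be moved along \<open>e\<^sub>i - e\<^sub>j\<close> if another
  coordinate \<open>j\<close> is non-integral; otherwise the coordinate sum is non-integral as well and the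
  point can be moved along \<open>e\<^sub>i\<close>.\<close>

lemma extreme_point_of_trunc_box_integral:
  fixes x :: "real ^ 'n"
  assumes x: "x extreme_point_of trunc_box u s"
  shows "x $ i \<in> \<int>"
proof (rule ccontr)
  assume i: "x $ i \<notin> \<int>"
  have mem: "x \<in> trunc_box u s" using x by (simp add: extreme_point_of_def)
  then have bounds: "0 \<le> x $ k \<and> x $ k \<le> u k" and total: "(\<Sum>k\<in>UNIV. x $ k) \<le> s" for k
    by (simp_all add: trunc_box_def)
  have strict: "0 < x $ k" "x $ k < u k" if "x $ k \<notin> \<int>" for k
  proof -
    have "x $ k \<noteq> 0" "x $ k \<noteq> u k" using that by auto
    then show "0 < x $ k" "x $ k < u k" using bounds[of k] by simp_all
  qed
  show False
  proof (cases "\<exists>j. j \<noteq> i \<and> x $ j \<notin> \<int>")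
    case True
    then obtain j where j: "j \<noteq> i" "x $ j \<notin> \<int>" by blast
    \<comment> \<open>A non-integral coordinate lies strictly between its integral bounds, so a
      positive step is possible in both directions.\<close>
    define e where "e = min (min (x $ i) (u i - x $ i)) (min (x $ j) (u j - x $ j))"
    have e: "e > 0" "e \<le> x $ i" "e \<le> u i - x $ i" "e \<le> x $ j" "e \<le> u j - x $ j"
      unfolding e_def using strict[OF i] strict[OF j(2)] by linarith+
    define v :: "real ^ 'n" where "v = axis i e - axis j e"
    have v: "v $ k = (if k = i then e else if k = j then - e else 0)" for k
      using j(1) by (auto simp: v_def axis_def)
    have "(\<Sum>k\<in>UNIV. v $ k) = 0" by (simp add: v_def sum_subtractf)
    moreover have "0 \<le> x $ k + v $ k" "x $ k + v $ k \<le> u k"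
        "0 \<le> x $ k - v $ k" "x $ k - v $ k \<le> u k" for k
      unfolding v using bounds[of k] e by simp_all
    ultimately have "x + v \<in> trunc_box u s" "x - v \<in> trunc_box u s"
      using total by (simp_all add: trunc_box_def sum.distrib sum_subtractf)
    moreover have "v \<noteq> 0" using v[of i] e(1) by auto
    ultimately show False using not_extreme_point_of_perturbation x by blast
  next
    case False
    have "(\<Sum>k\<in>UNIV. x $ k) = x $ i + (\<Sum>k\<in>-{i}. x $ k)"
      by (simp add: sum.remove[of UNIV i] Compl_eq_Diff_UNIV)
    moreover have "(\<Sum>k\<in>-{i}. x $ k) \<in> \<int>" using False by (intro Ints_sum) auto
    ultimately have "(\<Sum>k\<in>UNIV. x $ k) \<notin> \<int>"
      using i by (metis Ints_diff add_diff_cancel_right')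
    then have "(\<Sum>k\<in>UNIV. x $ k) \<noteq> s" by auto
    then have s: "(\<Sum>k\<in>UNIV. x $ k) < s" using total by simp
    define e where "e = min (min (x $ i) (u i - x $ i)) (s - (\<Sum>k\<in>UNIV. x $ k))"
    have e: "e > 0" "e \<le> x $ i" "e \<le> u i - x $ i" "e \<le> s - (\<Sum>k\<in>UNIV. x $ k)"
      unfolding e_def using strict[OF i] s by linarith+
    have "0 \<le> x $ k + axis i e $ k" "x $ k + axis i e $ k \<le> u k"
        "0 \<le> x $ k - axis i e $ k" "x $ k - axis i e $ k \<le> u k" for k
      using bounds[of k] e by (simp_all add: axis_def)
    then have "x + axis i e \<in> trunc_box u s" "x - axis i e \<in> trunc_box u s"
      using total e by (simp_all add: trunc_box_def sum.distrib sum_subtractf)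
    moreover have "axis i e \<noteq> 0" using e(1) by (simp add: axis_eq_0_iff)
    ultimately show False using not_extreme_point_of_perturbation x by blast
  qed
qed

lemma lattice_polytope_trunc_box: "lattice_polytope (trunc_box u s)"
  unfolding lattice_polytope_def
  using polytope_trunc_box extreme_point_of_trunc_box_integral by blast

text \<open>By Krein-Milman the truncated box is the hull of its extreme points. These are integral,
  hence already among the exponent vectors on the left.\<close>

lemma convex_hull_real_vec_eq_trunc_box:
  "convex hull (real_vec ` {a. (\<forall>i. Poly_Mapping.lookup a i \<le> u i) \<and>
     (\<Sum>i\<in>UNIV. Poly_Mapping.lookup a i) \<le> s}) = trunc_box u s"
  (is "convex hull ?V = _")
proof
  have "?V \<subseteq> trunc_box u s"
    by (auto simp: trunc_box_def real_vec_def simp flip: of_nat_sum)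
  then show "convex hull ?V \<subseteq> trunc_box u s"
    using polytope_imp_convex[OF polytope_trunc_box] by (intro hull_minimal) auto
next
  have "x \<in> ?V" if x: "x extreme_point_of trunc_box u s" for x
  proof -
    have mem: "x \<in> trunc_box u s" using x by (simp add: extreme_point_of_def)
    define f where "f i = nat \<lfloor>x $ i\<rfloor>" for i
    have f: "real (f i) = x $ i" for i
      using extreme_point_of_trunc_box_integral[OF x, of i] mem
      by (auto simp: f_def trunc_box_def elim!: Ints_cases)
    have "x = real_vec (Abs_poly_mapping f)" by (simp add: real_vec_def f vec_eq_iff)
    moreover have "f i \<le> u i" for i
      using mem f[of i] by (simp add: trunc_box_def flip: of_nat_le_iff[where 'a = real])
    moreover have "(\<Sum>i\<in>UNIV. f i) \<le> s"
      using mem by (simp add: trunc_box_def f flip: of_nat_le_iff[where 'a = real])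
    ultimately show ?thesis by (intro image_eqI[of _ _ "Abs_poly_mapping f"]) auto
  qed
  then have "convex hull {x. x extreme_point_of trunc_box u s} \<subseteq> convex hull ?V"
    by (intro hull_mono) blast
  moreover have "trunc_box u s = convex hull {x. x extreme_point_of trunc_box u s}"
    by (intro Krein_Milman_Minkowski polytope_imp_compact polytope_imp_convex polytope_trunc_box)
  ultimately show "trunc_box u s \<subseteq> convex hull ?V" by simp
qed

lemma trunc_box_eq_box:
  assumes "sum u UNIV \<le> s"
  shows "trunc_box u s = {x. \<forall>i. 0 \<le> x $ i \<and> x $ i \<le> real (u i)}"
proof -
  have "(\<Sum>i\<in>UNIV. x $ i) \<le> real s" if "\<forall>i. x $ i \<le> real (u i)" for x :: "real ^ 'a"
  proof -
    have "(\<Sum>i\<in>UNIV. x $ i) \<le> (\<Sum>i\<in>UNIV. real (u i))" using that by (intro sum_mono) auto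
    also have "\<dots> \<le> real s" using assms by (simp flip: of_nat_sum)
    finally show ?thesis .
  qed
  then show ?thesis by (auto simp: trunc_box_def)
qed

section \<open>The polytopes of the classification as truncated boxes\<close>

lemma translated_cube_eq:
  "(\<lambda>x. x + 1) ` cube_Q' = {x :: real ^ 'n. \<forall>i. 0 \<le> x $ i \<and> x $ i \<le> 2}"
proof -
  have "(\<lambda>x. x + 1) ` cube_Q' = (\<lambda>x :: real ^ 'n. 2 *\<^sub>R x) ` cube_Q"
    by (simp add: cube_Q'_def image_image)
  also have "\<dots> = {x. \<forall>i. 0 \<le> x $ i \<and> x $ i \<le> 2}"
  proof (intro equalityI subsetI)
    fix x :: "real ^ 'n" assume "x \<in> {x. \<forall>i. 0 \<le> x $ i \<and> x $ i \<le> 2}"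
    then show "x \<in> (\<lambda>x. 2 *\<^sub>R x) ` cube_Q"
      by (intro image_eqI[of _ _ "(1/2) *\<^sub>R x"]) (auto simp: cube_Q_def)
  qed (auto simp: cube_Q_def)
  finally show ?thesis .
qed

lemma translated_cube_eq_trunc_box:
  "(\<lambda>x. x + 1) ` cube_Q' = (trunc_box (\<lambda>i. 2) (2 * CARD('n)) :: (real ^ 'n::finite) set)"
  unfolding translated_cube_eq by (subst trunc_box_eq_box) auto

lemma cube_eq_trunc_box: "cube_Q = (trunc_box (\<lambda>i. 1) CARD('n) :: (real ^ 'n::finite) set)"
  unfolding cube_Q_def by (subst trunc_box_eq_box) auto

lemma P3_eq_trunc_box: "P3 = trunc_box (\<lambda>i. 1) 2"
  by (simp add: P3_def trunc_box_def)

section \<open>Reflexive polytopes\<close>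

lemma lattice_polytope_convex_hull:
  fixes V :: "(real ^ 'n) set"
  assumes "finite V" "\<And>v i. v \<in> V \<Longrightarrow> v $ i \<in> \<int>"
  shows "lattice_polytope (convex hull V)"
  unfolding lattice_polytope_def
proof (intro conjI allI impI)
  show "polytope (convex hull V)" using assms(1) unfolding polytope_def by blast
  show "v $ i \<in> \<int>" if "v extreme_point_of convex hull V" for v i
    using extreme_point_of_convex_hull[OF that] by (rule assms(2))
qed

text \<open>Affine maps commute with convex hulls, so the image is the hull of the images of the
  vertices, which stay integral.\<close>

lemma lattice_polytope_dilate_translate:
  fixes P :: "(real ^ 'n) set" and a :: "int ^ 'n"
  assumes "lattice_polytope P"
  shows "lattice_polytope ((\<lambda>x. of_int d *\<^sub>R x - (\<chi> i. of_int (a $ i))) ` P)"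
proof -
  let ?f = "\<lambda>x :: real ^ 'n. of_int d *\<^sub>R x - (\<chi> i. of_int (a $ i))"
  let ?V = "{x. x extreme_point_of P}"
  have P: "polytope P" and int: "\<And>v i. v \<in> ?V \<Longrightarrow> v $ i \<in> \<int>"
    using assms by (auto simp: lattice_polytope_def)
  have "finite ?V"
    using P finite_polyhedron_extreme_points polytope_imp_polyhedron by blast
  have f: "?f = (\<lambda>x. (- (\<chi> i. of_int (a $ i))) + of_int d *\<^sub>R x)" by auto
  have "P = convex hull ?V"
    using P by (intro Krein_Milman_Minkowski polytope_imp_compact polytope_imp_convex)
  then have "?f ` P = convex hull (?f ` ?V)"
    unfolding f convex_hull_affinity by simp
  moreover have "lattice_polytope (convex hull (?f ` ?V))"
    using \<open>finite ?V\<close> int by (intro lattice_polytope_convex_hull) (auto intro: Ints_mult Ints_diff)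
  ultimately show ?thesis by simp
qed

section \<open>Duality and reflexivity\<close>

lemma dual_polytope_eq: "dual_polytope P = {x. \<forall>y\<in>P. x \<bullet> y \<le> 1}"
  by (simp add: dual_polytope_def inner_vec_alt)

text \<open>A form of the bipolar theorem: a point outside the closed hull is strictly separated
  from it, and the rescaled separating functional is a point of the polyhedron that excludes the
  given point from the dual.\<close>

lemma dual_polytope_of_halfspaces:
  fixes N :: "(real ^ 'n) set"
  assumes "finite N" "0 \<in> convex hull N"
  shows "dual_polytope {y. \<forall>n\<in>N. n \<bullet> y \<le> 1} = convex hull N"
proof
  have "convex (dual_polytope {y. \<forall>n\<in>N. n \<bullet> y \<le> 1})"
  proof -
    have "dual_polytope {y. \<forall>n\<in>N. n \<bullet> y \<le> 1} = (\<Inter>y\<in>{y. \<forall>n\<in>N. n \<bullet> y \<le> 1}. {x. y \<bullet> x \<le> 1})"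
      by (auto simp: dual_polytope_eq inner_commute)
    then show ?thesis by (simp add: convex_INT convex_halfspace_le)
  qed
  then show "convex hull N \<subseteq> dual_polytope {y. \<forall>n\<in>N. n \<bullet> y \<le> 1}"
    by (intro hull_minimal) (auto simp: dual_polytope_eq)
next
  show "dual_polytope {y. \<forall>n\<in>N. n \<bullet> y \<le> 1} \<subseteq> convex hull N"
  proof (rule ccontr)
    assume "\<not> ?thesis"
    then obtain z where z: "\<And>y. (\<forall>n\<in>N. n \<bullet> y \<le> 1) \<Longrightarrow> z \<bullet> y \<le> 1" "z \<notin> convex hull N"
      by (auto simp: dual_polytope_eq)
    moreover have "closed (convex hull N)"
      using assms(1) by (simp add: compact_imp_closed finite_imp_compact_convex_hull)
    ultimately obtain h b where hb: "h \<bullet> z < b" "\<forall>x\<in>convex hull N. b < h \<bullet> x"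
      using separating_hyperplane_closed_point[of "convex hull N" z] by auto
    \<comment> \<open>Since \<open>b\<close> is negative, dividing by it reverses both inequalities:
      \<open>h / b\<close> satisfies all constraints from \<open>N\<close>, while its product with
      \<open>z\<close> exceeds 1.\<close>
    then have "b < 0" using assms(2) by force
    have "\<forall>n\<in>N. n \<bullet> (inverse b *\<^sub>R h) \<le> 1"
    proof
      fix n assume "n \<in> N"
      then have "b < h \<bullet> n" using hb(2) hull_inc by metis
      then show "n \<bullet> (inverse b *\<^sub>R h) \<le> 1"
        using \<open>b < 0\<close> by (simp add: field_simps inner_commute)
    qed
    then have "z \<bullet> (inverse b *\<^sub>R h) \<le> 1" by (rule z(1))
    then show False using hb(1) \<open>b < 0\<close> by (simp add: field_simps inner_commute)
  qed
qed

lemma zero_in_interior_halfspaces: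
  fixes N :: "(real ^ 'n) set"
  assumes "finite N"
  shows "0 \<in> interior {y. \<forall>n\<in>N. n \<bullet> y \<le> 1}"
proof (rule interiorI)
  have "{y. \<forall>n\<in>N. n \<bullet> y < 1} = (\<Inter>n\<in>N. {y. n \<bullet> y < 1})" by auto
  then show "open {y. \<forall>n\<in>N. n \<bullet> y < 1}"
    using assms by (simp add: open_INT open_halfspace_lt)
qed (auto intro: less_imp_le)

text \<open>The dual is the hull of the normals in \<open>N\<close>, so integral normals with
  right-hand side 1 make it a lattice polytope.\<close>

lemma reflexive_polytope_of_halfspaces:
  fixes N :: "(real ^ 'n) set"
  assumes "finite N" "\<And>n i. n \<in> N \<Longrightarrow> n $ i \<in> \<int>" "0 \<in> convex hull N"
    and "lattice_polytope {y. \<forall>n\<in>N. n \<bullet> y \<le> 1}"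
  shows "reflexive_polytope {y. \<forall>n\<in>N. n \<bullet> y \<le> 1}"
proof -
  have "aff_dim {y. \<forall>n\<in>N. n \<bullet> y \<le> 1} = int CARD('n)"
    using aff_dim_nonempty_interior[of "{y. \<forall>n\<in>N. n \<bullet> y \<le> 1}"]
      zero_in_interior_halfspaces[OF assms(1)] by auto
  then show ?thesis
    unfolding reflexive_polytope_def dual_polytope_of_halfspaces[OF assms(1,3)]
    using assms(4) zero_in_interior_halfspaces[OF assms(1)]
      lattice_polytope_convex_hull[OF assms(1,2)] by simp
qed

section \<open>Lattice distance of facets\<close>

text \<open>A small positive multiple of \<open>n\<close> lies in \<open>P\<close>, and its inner
  product with \<open>n\<close> is positive.\<close>

lemma zero_in_interior_imp_inner_bound_pos:
  fixes n :: "'a::euclidean_space"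
  assumes "0 \<in> interior P" "n \<noteq> 0" "\<And>y. y \<in> P \<Longrightarrow> n \<bullet> y \<le> b"
  shows "b > 0"
proof -
  obtain e where e: "e > 0" "cball 0 e \<subseteq> P"
    using assms(1) by (auto simp: mem_interior_cball)
  have "e *\<^sub>R sgn n \<in> P"
    using e assms(2) by (auto simp: norm_sgn)
  then have "n \<bullet> (e *\<^sub>R sgn n) \<le> b" by (rule assms(3))
  moreover have "n \<bullet> (e *\<^sub>R sgn n) = e * norm n"
    using assms(2) by (simp add: sgn_div_norm dot_square_norm power2_eq_square)
  moreover have "e * norm n > 0" using e(1) assms(2) by simp
  ultimately show ?thesis by linarith
qed

text \<open>If the points of \<open>F\<close> determine the supporting hyperplane \<open>n \<bullet> y = b\<close> up to scaling, then
  \<open>n / b\<close> is a vertex of the dual polytope, so \<open>1 / b\<close> is an integer.\<close>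

lemma reflexive_polytope_facet_distance:
  fixes P :: "(real ^ 'n) set"
  assumes refl: "reflexive_polytope P" and "b \<in> \<int>" and k: "n $ k \<in> {1, -1}"
    and le: "\<And>y. y \<in> P \<Longrightarrow> n \<bullet> y \<le> b"
    and F: "F \<subseteq> P" "F \<noteq> {}" "\<And>y. y \<in> F \<Longrightarrow> n \<bullet> y = b"
    and unique: "\<And>w. (\<And>y. y \<in> F \<Longrightarrow> w \<bullet> y = 1) \<Longrightarrow> \<exists>t. w = t *\<^sub>R n"
  shows "b = 1"
proof -
  have int: "0 \<in> interior P" and dual: "lattice_polytope (dual_polytope P)"
    using refl by (auto simp: reflexive_polytope_def)
  have "n \<noteq> 0" using k by auto
  then have "b > 0" using zero_in_interior_imp_inner_bound_pos[OF int _ le] by blast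
  define z where "z = inverse b *\<^sub>R n"
  have w_eq: "w = z" if w: "\<And>y. y \<in> F \<Longrightarrow> w \<bullet> y = 1" for w
  proof -
    obtain t where t: "w = t *\<^sub>R n" using unique w by blast
    obtain y where "y \<in> F" using F(2) by blast
    then have "t * b = 1" using w[of y] F(3)[of y] by (simp add: t)
    then have "t = inverse b" using \<open>b > 0\<close> by (simp add: field_simps)
    then show ?thesis by (simp add: t z_def)
  qed
  have z_dual: "z \<in> dual_polytope P"
    using le \<open>b > 0\<close> by (auto simp: dual_polytope_eq z_def field_simps)
  have "z extreme_point_of dual_polytope P"
    unfolding extreme_point_of_def
  proof (intro conjI ballI notI z_dual)
    fix p q assume pq: "p \<in> dual_polytope P" "q \<in> dual_polytope P" "z \<in> open_segment p q"
    then obtain t where t: "0 < t" "t < 1" "z = (1 - t) *\<^sub>R p + t *\<^sub>R q" and "p \<noteq> q"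
      by (auto simp: in_segment)
    \<comment> \<open>On \<open>F\<close> both inner products are at most 1 and a proper convex
      combination of them is 1, so each equals 1. Then \<open>w_eq\<close> identifies both points
      with \<open>z\<close>.\<close>
    have pq1: "p \<bullet> y = 1 \<and> q \<bullet> y = 1" if "y \<in> F" for y
    proof -
      have "p \<bullet> y \<le> 1" "q \<bullet> y \<le> 1"
        using pq(1,2) that F(1) by (auto simp: dual_polytope_eq)
      moreover have "(1 - t) * (p \<bullet> y) + t * (q \<bullet> y) = 1"
      proof -
        have "z \<bullet> y = 1" using F(3)[OF that] \<open>b > 0\<close> by (simp add: z_def)
        then show ?thesis by (simp add: t(3) inner_add_left)
      qed
      then have "(1 - t) * (1 - p \<bullet> y) + t * (1 - q \<bullet> y) = 0" by (simp add: algebra_simps)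
      ultimately show ?thesis
        using t(1,2) by (simp add: add_nonneg_eq_0_iff)
    qed
    then have "p = z" "q = z" by (auto intro: w_eq)
    then show False using \<open>p \<noteq> q\<close> by simp
  qed
  \<comment> \<open>As \<open>n $ k\<close> is 1 or -1, this coordinate is \<open>1 / b\<close> up
    to sign. So \<open>b\<close> and \<open>1 / b\<close> are positive integers with product
    1.\<close>
  then have "z $ k \<in> \<int>" using dual by (simp add: lattice_polytope_def)
  then have "inverse b \<in> \<int>" using k by (auto simp: z_def)
  then obtain i where i: "inverse b = of_int i" by (auto elim: Ints_cases)
  obtain j where j: "b = of_int j" using \<open>b \<in> \<int>\<close> by (auto elim: Ints_cases)
  have "j > 0" using \<open>b > 0\<close> j by simp
  moreover have "i > 0" using \<open>b > 0\<close> i by (metis of_int_0_less_iff positive_imp_inverse_positive)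
  moreover have "real_of_int (i * j) = 1" using \<open>b > 0\<close> by (simp flip: i j)
  then have "i * j = 1" by linarith
  ultimately have "j = 1" using zmult_eq_1_iff by (metis less_irrefl less_minus_one_simps(1) order_less_trans)
  then show ?thesis using j by simp
qed

section \<open>Gorenstein truncated boxes\<close>

lemma axis_in_trunc_box: "\<lbrakk>u j > 0; s > 0\<rbrakk> \<Longrightarrow> axis j 1 \<in> trunc_box u s"
  by (auto simp: trunc_box_def axis_def)

text \<open>The facets \<open>x_i = 0\<close>, \<open>x_i = u i\<close> and the cut are treated in
  turn. The bound \<open>u i < s\<close> leaves room on \<open>x_i = u i\<close> for a unit step in
  every other direction, and a total of \<open>Suc s\<close> places the points one unit step below
  the corner \<open>u\<close> on the cut.\<close>

lemma gorenstein_trunc_boxD: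
  fixes u :: "'n::finite \<Rightarrow> nat"
  assumes gor: "gorenstein_polytope (trunc_box u s)"
    and pos: "\<And>i. u i > 0" and less: "\<And>i. u i < s"
  obtains d :: int where "d > 0" "\<And>i. d * int (u i) = 2"
    "sum u UNIV = Suc s \<Longrightarrow> d * int s = int CARD('n) + 1"
proof -
  obtain d :: int and a :: "int ^ 'n" where d: "d > 0"
    and refl: "reflexive_polytope ((\<lambda>x. of_int d *\<^sub>R x - (\<chi> i. of_int (a $ i))) ` trunc_box u s)"
    using gor by (auto simp: gorenstein_polytope_def)
  define r :: "real ^ 'n" where "r = (\<chi> i. of_int (a $ i))"
  define f where "f x = of_int d *\<^sub>R x - r" for x :: "real ^ 'n"
  let ?P = "f ` trunc_box u s"
  have refl: "reflexive_polytope ?P" using refl by (simp add: f_def r_def)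
  have inner_f: "w \<bullet> f x = of_int d * (w \<bullet> x) - w \<bullet> r" for w x
    by (simp add: f_def inner_diff_right)
  have f_nth: "f x $ i = of_int d * x $ i - r $ i" for x i by (simp add: f_def)
  have w_axis: "w \<bullet> axis i t = w $ i * t" for w :: "real ^ 'n" and i and t :: real
    by (simp add: inner_axis)
  have axis_w: "axis i t \<bullet> w = t * w $ i" for w :: "real ^ 'n" and i and t :: real
    by (simp add: inner_axis inner_commute)
  have r_Ints: "r $ i \<in> \<int>" for i by (simp add: r_def)
  have s: "s > 0" using less[of undefined] by simp
  have uniq: "\<exists>t. w = t *\<^sub>R n" if "\<And>j. j \<noteq> i \<Longrightarrow> w $ j = 0" "n = axis i c" "c \<noteq> 0"
    for w n :: "real ^ 'n" and i c
    using that by (intro exI[of _ "w $ i / c"]) (auto simp: vec_eq_iff axis_def)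
  \<comment> \<open>Facet \<open>x_i = 0\<close>: the maximum of the outer normal
    \<open>-e_i\<close> on the image is \<open>r $ i\<close>. Comparing the origin with the unit
    vectors \<open>e_j\<close> on this facet shows that \<open>w\<close> vanishes off coordinate
    \<open>i\<close>.\<close>
  have r: "r $ i = 1" for i
  proof (rule reflexive_polytope_facet_distance[OF refl r_Ints])
    let ?F = "insert (f 0) {f (axis j 1) | j. j \<noteq> i}"
    show "axis i (-1) $ i \<in> {1, -1 :: real}" by simp
    show "axis i (-1) \<bullet> y \<le> r $ i" if "y \<in> ?P" for y
      using that d by (auto simp: f_nth axis_w trunc_box_def)
    have "axis j 1 \<in> trunc_box u s" for j using pos s by (rule axis_in_trunc_box)
    moreover have "0 \<in> trunc_box u s" by (simp add: trunc_box_def)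
    ultimately show "?F \<subseteq> ?P" by blast
    show "axis i (-1) \<bullet> y = r $ i" if "y \<in> ?F" for y
      using that by (auto simp: f_nth axis_w axis_def[of _ "1 :: real"])
    show "\<exists>t. w = t *\<^sub>R axis i (-1)" if w: "\<And>y. y \<in> ?F \<Longrightarrow> w \<bullet> y = 1" for w
    proof (rule uniq)
      fix j assume "j \<noteq> i"
      then have "w \<bullet> f (axis j 1) = 1" "w \<bullet> f 0 = 1" using w by auto
      then show "w $ j = 0" using d by (simp add: inner_f w_axis)
    qed auto
  qed auto
  \<comment> \<open>Facet \<open>x_i = u i\<close>: the maximum of coordinate \<open>i\<close> on
    the image is \<open>d * u i - r $ i\<close>, and \<open>r $ i\<close> is already known to be
    1.\<close>
  have du: "of_int d * real (u i) - 1 = (1 :: real)" for i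
  proof (rule reflexive_polytope_facet_distance[OF refl])
    let ?F = "insert (f (axis i (u i))) {f (axis i (u i) + axis j 1) | j. j \<noteq> i}"
    show "of_int d * real (u i) - 1 \<in> \<int>" by simp
    show "axis i 1 $ i \<in> {1, -1 :: real}" by simp
    show "axis i 1 \<bullet> y \<le> of_int d * real (u i) - 1" if "y \<in> ?P" for y
      using that d by (auto simp: f_nth axis_w r trunc_box_def)
    have "axis i (real (u i)) + axis j 1 \<in> trunc_box u s" if "j \<noteq> i" for j
      using less[of i] pos[of j] that by (auto simp: trunc_box_def sum.distrib) (auto simp: axis_def)
    moreover have "axis i (real (u i)) \<in> trunc_box u s"
      using less[of i] by (auto simp: trunc_box_def) (auto simp: axis_def)
    ultimately show "?F \<subseteq> ?P" by auto
    show "axis i 1 \<bullet> y = of_int d * real (u i) - 1" if "y \<in> ?F" for y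
      using that by (auto simp: f_nth axis_w r) (auto simp: axis_def)
    show "\<exists>t. w = t *\<^sub>R axis i 1" if w: "\<And>y. y \<in> ?F \<Longrightarrow> w \<bullet> y = 1" for w
    proof (rule uniq)
      fix j assume "j \<noteq> i"
      then have "w \<bullet> f (axis i (u i) + axis j 1) = 1" "w \<bullet> f (axis i (u i)) = 1" using w by auto
      then show "w $ j = 0" using d by (simp add: inner_f w_axis inner_add_right algebra_simps)
    qed auto
  qed auto
  have du_int: "d * int (u i) = 2" for i
  proof -
    have "real_of_int (d * int (u i)) = 2" using du[of i] by simp
    then show ?thesis by linarith
  qed
  \<comment> \<open>The cut: since all coordinates of \<open>r\<close> are 1, the maximum of the
    coordinate sum on the image is \<open>d * s - n\<close>, where \<open>n\<close> is the number of
    variables.\<close>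
  have ds: "of_int d * real s - real CARD('n) = (1 :: real)" if total: "sum u UNIV = Suc s"
  proof (rule reflexive_polytope_facet_distance[OF refl])
    define v :: "real ^ 'n" where "v = (\<chi> i. real (u i))"
    \<comment> \<open>The coordinates of the corner \<open>v\<close> add up to \<open>s + 1\<close>,
      so lowering any one of them by 1 leads to a point of the cut.\<close>
    let ?F = "{f (v - axis i 1) | i. True}"
    have sum_v: "(\<Sum>i\<in>UNIV. v $ i) = real s + 1"
      using total by (simp add: v_def flip: of_nat_sum)
    have one_inner: "1 \<bullet> x = (\<Sum>i\<in>UNIV. x $ i)" for x :: "real ^ 'n"
      by (simp add: inner_vec_alt)
    have one_r: "1 \<bullet> r = real CARD('n)" by (simp add: one_inner r)
    have one_f: "1 \<bullet> f x = of_int d * (\<Sum>i\<in>UNIV. x $ i) - real CARD('n)" for x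
      unfolding inner_f one_r by (simp only: one_inner)
    show "of_int d * real s - real CARD('n) \<in> \<int>" by simp
    show "(1 :: real ^ 'n) $ undefined \<in> {1, -1}" by simp
    show "1 \<bullet> y \<le> of_int d * real s - real CARD('n)" if "y \<in> ?P" for y
      using that d by (auto simp: one_f trunc_box_def)
    have "v - axis i 1 \<in> trunc_box u s" for i
      using pos[of i] by (auto simp: trunc_box_def sum_subtractf sum_v) (auto simp: axis_def v_def)
    then show "?F \<subseteq> ?P" by auto
    show "?F \<noteq> {}" by blast
    show "1 \<bullet> y = of_int d * real s - real CARD('n)" if "y \<in> ?F" for y
      using that by (auto simp: one_f sum_subtractf sum_v)
    show "\<exists>t. w = t *\<^sub>R 1" if w: "\<And>y. y \<in> ?F \<Longrightarrow> w \<bullet> y = 1" for w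
    proof -
      \<comment> \<open>Equal values at two of these points force equal coordinates of
        \<open>w\<close>. Here \<open>undefined\<close> serves as an arbitrary fixed index.\<close>
      have "w $ i = w $ undefined" for i
      proof -
        have "w \<bullet> f (v - axis i 1) = 1" "w \<bullet> f (v - axis undefined 1) = 1" using w by blast+
        then show ?thesis using d by (simp add: inner_f w_axis inner_diff_right algebra_simps)
      qed
      then show ?thesis by (intro exI[of _ "w $ undefined"]) (simp add: vec_eq_iff)
    qed
  qed
  have "d * int s = int CARD('n) + 1" if "sum u UNIV = Suc s"
  proof -
    have "real_of_int (d * int s) = real_of_int (int CARD('n) + 1)" using ds[OF that] by simp
    then show ?thesis by (simp only: of_int_eq_iff)
  qed
  then show thesis using that d du_int by blast
qed

lemma aff_dim_trunc_box:
  fixes u :: "'n::finite \<Rightarrow> nat"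
  assumes "\<And>i. u i > 0" "s > 0"
  shows "aff_dim (trunc_box u s) = int CARD('n)"
proof -
  let ?U = "box 0 (\<chi> i. real (u i)) \<inter> {x. 1 \<bullet> x < real s}"
  \<comment> \<open>The coordinates are positive, less than 1 and add up to 1/2, so every constraint
    holds strictly.\<close>
  let ?x = "(\<chi> i. 1 / (2 * real CARD('n))) :: real ^ 'n"
  have one_le: "1 \<le> real CARD('n)" using zero_less_card_finite[where 'a = 'n] by (simp add: Suc_leI)
  have "1 / (2 * real CARD('n)) < real (u i)" for i
  proof -
    have "1 < 2 * real CARD('n)" using one_le by linarith
    then have "1 / (2 * real CARD('n)) < 1" by simp
    then show ?thesis using assms(1)[of i] by linarith
  qed
  then have "?x \<in> ?U"
    using assms(2) by (auto simp: mem_box_cart inner_vec_alt)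
  moreover have "?U \<subseteq> interior (trunc_box u s)"
    by (intro interior_maximal open_Int open_box open_halfspace_lt)
      (auto simp: trunc_box_def mem_box_cart inner_vec_alt less_imp_le)
  ultimately show ?thesis using aff_dim_nonempty_interior[of "trunc_box u s"] by auto
qed

text \<open>Dilating by \<open>d\<close> and subtracting the all-ones vector turns the box into
  \<open>[-1,1]^n\<close> and bounds the coordinate sum by \<open>d * s - n\<close>. This bound is 1
  in the first alternative; in the second it is at least \<open>n\<close>, so the cut is
  vacuous.\<close>

lemma gorenstein_trunc_boxI:
  fixes u :: "'n::finite \<Rightarrow> nat"
  assumes "d > 0" and du: "\<And>i. d * u i = 2" and s: "d * s = CARD('n) + 1 \<or> 2 * CARD('n) \<le> d * s"
  shows "gorenstein_polytope (trunc_box u s)"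
proof -
  let ?f = "\<lambda>x :: real ^ 'n. of_int (int d) *\<^sub>R x - (\<chi> i. of_int ((\<chi> i. 1) $ i))"
  \<comment> \<open>The outer normals, all with right-hand side 1; the all-ones normal enters only
    when the cut also has right-hand side 1.\<close>
  define N :: "(real ^ 'n) set" where
    "N = range (\<lambda>i. axis i 1) \<union> range (\<lambda>i. axis i (-1)) \<union> (if d * s = CARD('n) + 1 then {1} else {})"
  have pos: "u i > 0" for i using du[of i] by (cases "u i") auto
  have "s > 0" using s zero_less_card_finite[where 'a = 'n] by (cases s) auto
  have du_real: "real d * real (u i) = 2" for i using du[of i] by (metis of_nat_mult of_nat_numeral)
  have ds_real: "d * s = CARD('n) + 1 \<longleftrightarrow> real d * real s = CARD('n) + 1"
    by (metis of_nat_1 of_nat_add of_nat_eq_iff of_nat_mult)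
  have N_iff: "(\<forall>n\<in>N. n \<bullet> y \<le> 1) \<longleftrightarrow> (\<forall>i. -1 \<le> y $ i \<and> y $ i \<le> 1) \<and>
      (d * s = CARD('n) + 1 \<longrightarrow> (\<Sum>i\<in>UNIV. y $ i) \<le> 1)" for y
    unfolding N_def by (auto simp: inner_axis' inner_vec_alt[of 1] ball_Un minus_le_iff)
  have image: "?f ` trunc_box u s = {y. \<forall>n\<in>N. n \<bullet> y \<le> 1}"
  proof (intro equalityI subsetI)
    fix y assume "y \<in> ?f ` trunc_box u s"
    then obtain x where x: "x \<in> trunc_box u s" and y: "y = ?f x" by blast
    have "real d * x $ i \<le> 2" for i
      using x \<open>d > 0\<close> du_real[of i] mult_left_mono[of "x $ i" "u i" "real d"] by (simp add: trunc_box_def)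
    moreover have "real d * x $ i \<ge> 0" for i using x by (simp add: trunc_box_def)
    moreover have "real d * (\<Sum>i\<in>UNIV. x $ i) \<le> real d * real s"
      using x by (intro mult_left_mono) (auto simp: trunc_box_def)
    ultimately show "y \<in> {y. \<forall>n\<in>N. n \<bullet> y \<le> 1}"
      unfolding mem_Collect_eq N_iff y ds_real
      by (auto simp: sum_subtractf sum_distrib_left)
  next
    fix y assume "y \<in> {y. \<forall>n\<in>N. n \<bullet> y \<le> 1}"
    then have y: "\<And>i. -1 \<le> y $ i" "\<And>i. y $ i \<le> 1"
        "real d * real s = CARD('n) + 1 \<Longrightarrow> (\<Sum>i\<in>UNIV. y $ i) \<le> 1"
      unfolding mem_Collect_eq N_iff ds_real by auto
    define x where "x = inverse (real d) *\<^sub>R (y + 1)"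
    have dx: "real d * x $ i = y $ i + 1" for i using \<open>d > 0\<close> by (simp add: x_def)
    have "0 \<le> x $ i" for i using y(1)[of i] \<open>d > 0\<close> by (simp add: x_def)
    moreover have "x $ i \<le> u i" for i
    proof -
      have "real d * x $ i \<le> real d * u i" unfolding dx du_real using y(2)[of i] by simp
      then show ?thesis using \<open>d > 0\<close> by simp
    qed
    moreover have "(\<Sum>i\<in>UNIV. x $ i) \<le> s"
    proof -
      have "real d * (\<Sum>i\<in>UNIV. x $ i) = (\<Sum>i\<in>UNIV. y $ i) + CARD('n)"
        by (simp add: sum_distrib_left dx sum.distrib)
      also have "\<dots> \<le> real d * s"
        using s
      proof
        assume "d * s = CARD('n) + 1"
        then show ?thesis using y(3) unfolding ds_real by simp
      next
        assume "2 * CARD('n) \<le> d * s"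
        then have "2 * real CARD('n) \<le> real d * real s"
          by (metis of_nat_le_iff of_nat_mult of_nat_numeral)
        moreover have "(\<Sum>i\<in>UNIV. y $ i) \<le> CARD('n)"
          using sum_bounded_above[of UNIV "\<lambda>i. y $ i" 1] y(2) by simp
        ultimately show ?thesis by simp
      qed
      finally show ?thesis using \<open>d > 0\<close> by simp
    qed
    ultimately have "x \<in> trunc_box u s" by (simp add: trunc_box_def)
    moreover have "y = ?f x" by (simp add: vec_eq_iff dx)
    ultimately show "y \<in> ?f ` trunc_box u s" by blast
  qed
  have "0 \<in> convex hull N"
  proof -
    have "axis undefined 1 \<in> convex hull N" "axis undefined (-1) \<in> convex hull N"
      by (auto simp: N_def intro: hull_inc)
    then have "(1/2) *\<^sub>R axis undefined 1 + (1/2) *\<^sub>R axis undefined (-1) \<in> convex hull N"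
      by (intro convexD convex_convex_hull) auto
    moreover have "(1/2) *\<^sub>R axis undefined 1 + (1/2) *\<^sub>R axis undefined (-1) = (0 :: real ^ 'n)"
      by (simp add: vec_eq_iff axis_def)
    ultimately show ?thesis by simp
  qed
  then have "reflexive_polytope (?f ` trunc_box u s)"
    unfolding image
  proof (intro reflexive_polytope_of_halfspaces)
    show "lattice_polytope {y. \<forall>n\<in>N. n \<bullet> y \<le> 1}"
      unfolding image[symmetric]
      by (rule lattice_polytope_dilate_translate[OF lattice_polytope_trunc_box])
  qed (auto simp: N_def axis_def split: if_splits)
  moreover have "int d > 0" using \<open>d > 0\<close> by simp
  ultimately show ?thesis
    unfolding gorenstein_polytope_def
    using lattice_polytope_trunc_box aff_dim_trunc_box[of u s, OF pos \<open>s > 0\<close>] by blast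
qed

text \<open>The equations \<open>d * u i = 2\<close> leave \<open>d = 1\<close> with all sides 2 or
  \<open>d = 2\<close> with all sides 1. In the second case an odd \<open>n\<close> gives
  \<open>s = n - 1\<close>, and the facet of the cut yields
  \<open>2 * (n - 1) = n + 1\<close>.\<close>

lemma gorenstein_balanced_cases:
  fixes u :: "'n::finite \<Rightarrow> nat"
  assumes card: "CARD('n) \<ge> 3" and pos: "\<And>i. u i > 0" and balanced: "\<And>i. 2 * u i \<le> sum u UNIV"
    and gor: "gorenstein_polytope (trunc_box u (2 * (sum u UNIV div 2)))"
  shows "u = (\<lambda>i. 2) \<or> u = (\<lambda>i. 1) \<and> (even CARD('n) \<or> CARD('n) = 3)"
proof -
  let ?s = "2 * (sum u UNIV div 2)"
  \<comment> \<open>A side of length 1 is below \<open>?s\<close> because the total is at least 3. A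
    longer side is at most half the total, and rounding down to an even number loses at most
    1.\<close>
  have "u i < ?s" for i
  proof (cases "u i = 1")
    case True
    have "(\<Sum>i\<in>(UNIV :: 'n set). 1) \<le> sum u UNIV" using pos by (intro sum_mono) (simp add: Suc_leI)
    then show ?thesis using True card by simp
  next
    case False
    then show ?thesis using pos[of i] balanced[of i] by linarith
  qed
  with gor pos obtain d :: int where d: "d > 0" "\<And>i. d * int (u i) = 2"
    "sum u UNIV = Suc ?s \<Longrightarrow> d * int ?s = int CARD('n) + 1"
    using gorenstein_trunc_boxD[of u ?s] by blast
  have "d \<le> 2" using d(2)[of undefined] zdvd_imp_le[of d 2] by (metis dvd_triv_left zero_less_numeral)
  then consider "d = 1" | "d = 2" using d(1) by linarith
  then show ?thesis
  proof cases
    case 1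
    then have "u i = 2" for i using d(2)[of i] by simp
    then show ?thesis by auto
  next
    case 2
    then have u: "u i = 1" for i using d(2)[of i] by simp
    then have U: "sum u UNIV = CARD('n)" by simp
    have "CARD('n) = 3" if "odd CARD('n)"
    proof -
      have "CARD('n) = Suc ?s" using that unfolding U by simp
      then have "2 * int ?s = int CARD('n) + 1" using d(3) 2 unfolding U by simp
      then show ?thesis using \<open>CARD('n) = Suc ?s\<close> by linarith
    qed
    then show ?thesis using u by auto
  qed
qed

section \<open>Monomial ideals\<close>

text \<open>This is divisibility of monomials expressed on exponents, see
  \<open>mono_of_dvd_iff\<close>. It makes membership in monomial ideals a purely combinatorial
  matter.\<close>

definition mono_le :: "('n \<Rightarrow>\<^sub>0 nat) \<Rightarrow> ('n \<Rightarrow>\<^sub>0 nat) \<Rightarrow> bool" (infix "\<preceq>" 50) where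
  "a \<preceq> b \<longleftrightarrow> (\<forall>i. Poly_Mapping.lookup a i \<le> Poly_Mapping.lookup b i)"

lemma mono_le_refl [simp]: "a \<preceq> a"
  by (simp add: mono_le_def)

lemma mono_le_Bex: "a \<in> A \<Longrightarrow> \<exists>b\<in>A. b \<preceq> a"
  using mono_le_refl by blast

lemma mono_le_trans: "a \<preceq> b \<Longrightarrow> b \<preceq> c \<Longrightarrow> a \<preceq> c"
  unfolding mono_le_def using order_trans by blast

lemma mono_le_antisym: "a \<preceq> b \<Longrightarrow> b \<preceq> a \<Longrightarrow> a = b"
  unfolding mono_le_def by (intro poly_mapping_eqI) (simp add: le_antisym)

lemma mono_le_add_iff: "a \<preceq> b \<longleftrightarrow> (\<exists>d. b = d + a)"
proof
  assume "a \<preceq> b"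
  then have "b = (b - a) + a"
    by (intro poly_mapping_eqI) (simp add: mono_le_def lookup_add lookup_minus)
  then show "\<exists>d. b = d + a" ..
qed (auto simp: mono_le_def lookup_add)

lemma mono_le_add_mono: "a \<preceq> b \<Longrightarrow> c \<preceq> d \<Longrightarrow> a + c \<preceq> b + d"
  by (simp add: mono_le_def lookup_add add_mono)

text \<open>The ring as a module over itself: this makes the general facts about spans available for
  ideals.\<close>

lemma module_times: "module ((*) :: 'a::comm_ring_1 \<Rightarrow> 'a \<Rightarrow> 'a)"
  by unfold_locales (simp_all add: algebra_simps)

lemma mono_of_mult: "mono_of a * mono_of b = mono_of (a + b)"
  by (simp add: mono_of_def mult_single)

lemma mono_of_prod: "finite J \<Longrightarrow> (\<Prod>j\<in>J. mono_of (e j)) = mono_of (\<Sum>j\<in>J. e j)"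
proof (induction J rule: finite_induct)
  case empty
  then show ?case by (simp add: mono_of_def)
next
  case (insert x F)
  then show ?case by (simp add: mono_of_mult)
qed

lemma keys_mono_of [simp]: "Poly_Mapping.keys (mono_of a :: ('n, 'k::field) mpoly) = {a}"
  by (simp add: mono_of_def)

lemma poly_mapping_eq_sum_single:
  "(\<Sum>k\<in>Poly_Mapping.keys p. Poly_Mapping.single k (Poly_Mapping.lookup p k)) = p"
  by (rule poly_mapping_eqI) (auto simp: lookup_sum lookup_single when_def in_keys_iff sum.delta)

text \<open>The right-hand side is an ideal because every exponent of a product is a sum of
  exponents of the factors. Conversely, each single term of such a polynomial is a multiple of a
  generator.\<close>

lemma ideal_gen_monomials:
  "ideal_gen (mono_of ` A :: ('n, 'k::field) mpoly set) = {p. \<forall>k\<in>Poly_Mapping.keys p. \<exists>a\<in>A. a \<preceq> k}"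
  (is "_ = ?R")
proof
  have "module.subspace (*) ?R"
  proof (subst module.subspace_def[OF module_times], intro conjI ballI allI)
    fix p q :: "('n, 'k) mpoly"
    assume "p \<in> ?R" "q \<in> ?R"
    then show "p + q \<in> ?R"
      using keys_add[of p q] by blast
  next
    fix p q :: "('n, 'k) mpoly"
    assume q: "q \<in> ?R"
    show "p * q \<in> ?R"
    proof clarify
      fix k assume "k \<in> Poly_Mapping.keys (p * q)"
      then obtain i j where k: "k = i + j" and "j \<in> Poly_Mapping.keys q"
        using keys_mult[of p q] by blast
      then obtain a where "a \<in> A" "a \<preceq> j"
        using q by blast
      moreover from this(2) have "a \<preceq> k"
        by (simp add: k mono_le_def lookup_add trans_le_add2)
      ultimately show "\<exists>a\<in>A. a \<preceq> k" by blast
    qed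
  qed simp
  moreover have "mono_of ` A \<subseteq> ?R"
    by (clarsimp, rule mono_le_Bex)
  ultimately show "ideal_gen (mono_of ` A) \<subseteq> ?R"
    unfolding ideal_gen_def by (intro module.span_minimal[OF module_times])
next
  show "?R \<subseteq> ideal_gen (mono_of ` A)"
  proof
    fix p :: "('n, 'k) mpoly"
    assume p: "p \<in> ?R"
    have "Poly_Mapping.single k (Poly_Mapping.lookup p k) \<in> ideal_gen (mono_of ` A)" if k: "k \<in> Poly_Mapping.keys p" for k
    proof -
      obtain a d where "a \<in> A" "k = d + a"
        using p k by (auto simp: mono_le_add_iff)
      moreover from this(2) have "Poly_Mapping.single k (Poly_Mapping.lookup p k) = Poly_Mapping.single d (Poly_Mapping.lookup p k) * mono_of a"
        by (simp add: mono_of_def mult_single)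
      ultimately show ?thesis
        unfolding ideal_gen_def
        using module.span_scale[OF module_times] module.span_base[OF module_times]
        by (metis image_eqI)
    qed
    then have "(\<Sum>k\<in>Poly_Mapping.keys p. Poly_Mapping.single k (Poly_Mapping.lookup p k)) \<in> ideal_gen (mono_of ` A)"
      unfolding ideal_gen_def by (intro module.span_sum[OF module_times])
    then show "p \<in> ideal_gen (mono_of ` A)"
      by (simp add: poly_mapping_eq_sum_single)
  qed
qed

lemma mono_of_in_ideal_gen_monomials:
  "(mono_of b :: ('n, 'k::field) mpoly) \<in> ideal_gen (mono_of ` A) \<longleftrightarrow> (\<exists>a\<in>A. a \<preceq> b)"
  by (simp add: ideal_gen_monomials)

lemma ideal_gen_monomials_eq_iff:
  "ideal_gen (mono_of ` A :: ('n, 'k::field) mpoly set) = ideal_gen (mono_of ` B) \<longleftrightarrow>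
     (\<forall>b. (\<exists>a\<in>A. a \<preceq> b) \<longleftrightarrow> (\<exists>a\<in>B. a \<preceq> b))" (is "?L = ?R")
proof
  assume ?L
  then show ?R by (metis mono_of_in_ideal_gen_monomials)
next
  assume ?R
  then show ?L by (simp add: ideal_gen_monomials)
qed

lemma ideal_gen_monomials_eq_0_iff:
  "ideal_gen (mono_of ` A :: ('n, 'k::field) mpoly set) = {0} \<longleftrightarrow> A = {}"
proof
  assume *: "ideal_gen (mono_of ` A :: ('n, 'k) mpoly set) = {0}"
  show "A = {}"
  proof (rule ccontr)
    assume "A \<noteq> {}"
    then obtain a where "a \<in> A" by blast
    then have "\<exists>b\<in>A. b \<preceq> a" by (rule mono_le_Bex)
    then have "(mono_of a :: ('n, 'k) mpoly) \<in> ideal_gen (mono_of ` A)"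
      unfolding mono_of_in_ideal_gen_monomials .
    then have "(mono_of a :: ('n, 'k) mpoly) = 0" unfolding * by simp
    then show False
      using keys_mono_of[of a] by (metis keys_zero insert_not_empty)
  qed
next
  assume "A = {}"
  then show "ideal_gen (mono_of ` A :: ('n, 'k) mpoly set) = {0}"
    unfolding ideal_gen_monomials by auto
qed

text \<open>Each exponent of a product of \<open>q\<close> ideal elements is a sum of exponents of
  the factors, and each summand dominates an element of \<open>A\<close>; the induction runs over
  the number of factors.\<close>

lemma ideal_power_monomials:
  "ideal_power (ideal_gen (mono_of ` A)) q =
     (ideal_gen (mono_of ` {\<Sum>j<q. e j | e. \<forall>j<q. e j \<in> A}) :: ('n, 'k::field) mpoly set)"
  (is "_ = ideal_gen (mono_of ` ?S q)")
proof
  have "(\<Prod>j<m. f j) \<in> ideal_gen (mono_of ` ?S m)"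
    if "\<forall>j<m. f j \<in> ideal_gen (mono_of ` A)" for m and f :: "nat \<Rightarrow> ('n, 'k) mpoly"
    using that
  proof (induction m)
    case 0
    show ?case unfolding ideal_gen_monomials by simp
  next
    case (Suc m)
    then have IH: "(\<Prod>j<m. f j) \<in> ideal_gen (mono_of ` ?S m)" by simp
    show ?case
      unfolding ideal_gen_monomials
    proof clarify
      fix k assume "k \<in> Poly_Mapping.keys (\<Prod>j<Suc m. f j)"
      then obtain i j where k: "k = i + j" "i \<in> Poly_Mapping.keys (\<Prod>j<m. f j)" "j \<in> Poly_Mapping.keys (f m)"
        using keys_mult[of "\<Prod>j<m. f j" "f m"] by auto
      obtain e where e: "\<forall>j<m. e j \<in> A" "(\<Sum>j<m. e j) \<preceq> i"
        using k(2) IH unfolding ideal_gen_monomials by blast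
      obtain a where a: "a \<in> A" "a \<preceq> j"
        using k(3) Suc.prems unfolding ideal_gen_monomials by blast
      have "(\<Sum>j<Suc m. (e(m := a)) j) \<preceq> k"
        using mono_le_add_mono[OF e(2) a(2)] by (simp add: k(1))
      moreover have "\<forall>j<Suc m. (e(m := a)) j \<in> A"
        using e(1) a(1) by (simp add: less_Suc_eq)
      ultimately show "\<exists>b\<in>?S (Suc m). b \<preceq> k" by blast
    qed
  qed
  then show "ideal_power (ideal_gen (mono_of ` A)) q \<subseteq>
      (ideal_gen (mono_of ` ?S q) :: ('n, 'k) mpoly set)"
    unfolding ideal_power_def ideal_gen_def[of "Collect _"]
    by (intro module.span_minimal[OF module_times])
      (auto simp: ideal_gen_def intro: module.subspace_span[OF module_times])
next
  have "mono_of ` ?S q \<subseteq> {\<Prod>j<q. f j | f. \<forall>j<q. f j \<in> (ideal_gen (mono_of ` A) :: ('n, 'k) mpoly set)}"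
  proof clarify
    fix e :: "nat \<Rightarrow> 'n \<Rightarrow>\<^sub>0 nat" assume "\<forall>j<q. e j \<in> A"
    then have "\<forall>j<q. mono_of (e j) \<in> (ideal_gen (mono_of ` A) :: ('n, 'k) mpoly set)"
      unfolding mono_of_in_ideal_gen_monomials using mono_le_refl by blast
    then show "\<exists>f. mono_of (\<Sum>j<q. e j) = (\<Prod>j<q. f j) \<and> (\<forall>j<q. f j \<in> (ideal_gen (mono_of ` A) :: ('n, 'k) mpoly set))"
      by (intro exI[of _ "\<lambda>j. mono_of (e j)"]) (simp add: mono_of_prod)
  qed
  then show "ideal_gen (mono_of ` ?S q) \<subseteq> (ideal_power (ideal_gen (mono_of ` A)) q :: ('n, 'k) mpoly set)"
    unfolding ideal_power_def ideal_gen_def[of "mono_of ` ?S q"] ideal_gen_def[of "Collect _"]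
    by (intro module.span_mono[OF module_times])
qed

lemma bounded_part_monomials:
  "bounded_part c (ideal_gen (mono_of ` A)) =
     (ideal_gen (mono_of ` {b. (\<exists>a\<in>A. a \<preceq> b) \<and> (\<forall>i. Poly_Mapping.lookup b i \<le> c i)}) :: ('n, 'k::field) mpoly set)"
  unfolding bounded_part_def mono_of_in_ideal_gen_monomials
  by (rule arg_cong[where f = ideal_gen]) auto

text \<open>The assumptions make \<open>M\<close> the set of minimal elements of \<open>A\<close>.
  Every monomial generating set contains \<open>M\<close>, so an irredundant one equals it.\<close>

lemma min_mono_gens_monomials:
  assumes antichain: "\<And>a b. a \<in> M \<Longrightarrow> b \<in> M \<Longrightarrow> a \<preceq> b \<Longrightarrow> a = b"
    and "M \<subseteq> A" and min: "\<And>a. a \<in> A \<Longrightarrow> \<exists>m\<in>M. m \<preceq> a"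
  shows "min_mono_gens (ideal_gen (mono_of ` A)) = (mono_of ` M :: ('n, 'k::field) mpoly set)"
  unfolding min_mono_gens_def
proof (rule the_equality, intro conjI allI impI)
  have up: "(\<exists>a\<in>A. a \<preceq> b) \<longleftrightarrow> (\<exists>m\<in>M. m \<preceq> b)" for b
    using \<open>M \<subseteq> A\<close> min mono_le_trans by blast
  show gen: "ideal_gen (mono_of ` M) = (ideal_gen (mono_of ` A) :: ('n, 'k) mpoly set)"
    unfolding ideal_gen_monomials_eq_iff using up by blast
  show "ideal_gen B' \<noteq> ideal_gen (mono_of ` A)"
    if "B' \<subset> mono_of ` M" for B' :: "('n, 'k) mpoly set"
  proof
    from that have "B' \<subseteq> mono_of ` M" by blast
    then obtain M' where "M' \<subseteq> M" "B' = mono_of ` M'" by (rule subset_imageE)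
    then have M': "M' \<subset> M" "B' = mono_of ` M'"
      using that by auto
    then obtain m where m: "m \<in> M" "m \<notin> M'" by blast
    assume "ideal_gen B' = ideal_gen (mono_of ` A)"
    then have "\<exists>b\<in>M'. b \<preceq> m"
      using m(1) up unfolding M'(2) ideal_gen_monomials_eq_iff by (metis mono_le_refl)
    then show False
      using M'(1) m antichain by blast
  qed
  fix B :: "('n, 'k) mpoly set"
  assume B: "B \<subseteq> range mono_of \<and> ideal_gen B = ideal_gen (mono_of ` A) \<and>
      (\<forall>B'. B' \<subset> B \<longrightarrow> ideal_gen B' \<noteq> ideal_gen (mono_of ` A))"
  then obtain N where N: "B = mono_of ` N"
    by (metis subset_imageE)
  have "ideal_gen (mono_of ` N) = (ideal_gen (mono_of ` A) :: ('n, 'k) mpoly set)"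
    using B N by simp
  then have N_up: "(\<exists>a\<in>N. a \<preceq> b) \<longleftrightarrow> (\<exists>m\<in>M. m \<preceq> b)" for b
    unfolding ideal_gen_monomials_eq_iff up by (rule spec)
  have "M \<subseteq> N"
  proof
    fix m assume m: "m \<in> M"
    \<comment> \<open>A generator \<open>b\<close> lies below \<open>m\<close> and some
      \<open>m'\<close> of \<open>M\<close> lies below \<open>b\<close>. The antichain property
      gives \<open>m' = m\<close>, so \<open>b\<close> is squeezed to \<open>m\<close>.\<close>
    then obtain b where b: "b \<in> N" "b \<preceq> m" using N_up mono_le_refl by blast
    then obtain m' where "m' \<in> M" "m' \<preceq> b" using N_up mono_le_refl by blast
    then have "b = m" using antichain m b mono_le_trans mono_le_antisym by metis
    then show "m \<in> N" using b(1) by simp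
  qed
  then have "mono_of ` M \<subseteq> B" using N by blast
  then show "B = mono_of ` M" using B gen by blast
qed auto

lemma mono_of_dvd_iff: "mono_of a dvd (mono_of b :: ('n, 'k::field) mpoly) \<longleftrightarrow> a \<preceq> b"
proof
  assume "mono_of a dvd (mono_of b :: ('n, 'k) mpoly)"
  then obtain p :: "('n, 'k) mpoly" where "mono_of b = mono_of a * p" by (rule dvdE)
  then have "b \<in> Poly_Mapping.keys (mono_of a * p)" using keys_mono_of[of b] by (metis singletonI)
  then obtain d where "b = a + d" using keys_mult[of "mono_of a" p] by auto
  then show "a \<preceq> b" by (simp add: mono_le_def lookup_add)
next
  assume "a \<preceq> b"
  then obtain d where "b = d + a" unfolding mono_le_add_iff by blast
  then show "mono_of a dvd (mono_of b :: ('n, 'k) mpoly)"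
    by (metis mono_of_mult dvd_triv_right)
qed

section \<open>Powers of the edge ideal of a complete graph\<close>

text \<open>These are the exponents of the products of \<open>q\<close> edges of the complete graph,
  as \<open>sums_of_edge_monomials\<close> shows.\<close>

definition edge_sums :: "nat \<Rightarrow> ('n::finite \<Rightarrow>\<^sub>0 nat) set" where
  "edge_sums q = {b. (\<Sum>i\<in>UNIV. Poly_Mapping.lookup b i) = 2 * q \<and> (\<forall>i. Poly_Mapping.lookup b i \<le> q)}"

definition edge_monomials :: "('n \<Rightarrow>\<^sub>0 nat) set" where
  "edge_monomials = {Poly_Mapping.single i 1 + Poly_Mapping.single j 1 | i j. i \<noteq> j}"

lemma edge_ideal_complete_graph:
  "edge_ideal complete_graph = (ideal_gen (mono_of ` edge_monomials) :: ('n, 'k::field) mpoly set)"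
proof -
  have "{i, j} \<in> complete_graph \<longleftrightarrow> i \<noteq> j" for i j :: 'n
    by (auto simp: complete_graph_def doubleton_eq_iff)
  then have "{Var i * Var j | i j. {i, j} \<in> complete_graph} = (mono_of ` edge_monomials :: ('n, 'k) mpoly set)"
    unfolding edge_monomials_def by (auto simp: Var_def mono_of_mult)
  then show ?thesis by (simp add: edge_ideal_def)
qed

lemma sum_lookup_edge:
  fixes i j :: "'n::finite"
  shows "(\<Sum>k\<in>UNIV. Poly_Mapping.lookup (Poly_Mapping.single i (1::nat) + Poly_Mapping.single j 1) k) = 2"
  by (simp add: lookup_add lookup_single when_def sum.distrib)

text \<open>A greedy choice: remove the edge joining a largest entry \<open>i\<close> and a largest
  entry \<open>j\<close> among the others.\<close>

lemma edge_sums_Suc_decompose: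
  assumes "b \<in> edge_sums (Suc q)"
  obtains i j b' where "i \<noteq> j" "b' \<in> edge_sums q"
    "b = b' + (Poly_Mapping.single i 1 + Poly_Mapping.single j 1)"
proof -
  let ?b = "Poly_Mapping.lookup b"
  have total: "(\<Sum>k\<in>UNIV. ?b k) = 2 * Suc q" and le: "\<And>k. ?b k \<le> Suc q"
    using assms by (auto simp: edge_sums_def)
  have "Max (range ?b) \<in> range ?b" by (intro Max_in) auto
  then obtain i where "?b i = Max (range ?b)" by (metis imageE)
  then have i: "?b k \<le> ?b i" for k by simp
  have split_i: "(\<Sum>k\<in>UNIV. ?b k) = ?b i + (\<Sum>k\<in>-{i}. ?b k)"
    by (simp add: sum.remove[of UNIV i] Compl_eq_Diff_UNIV)
  \<comment> \<open>The entry at \<open>i\<close> is at most \<open>Suc q\<close>, which is only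
    half of the total.\<close>
  then have pos: "(\<Sum>k\<in>-{i}. ?b k) > 0"
    using total le[of i] by simp
  then have "-{i} \<noteq> {}" by (metis sum.empty less_irrefl)
  then have "Max (?b ` (-{i})) \<in> ?b ` (-{i})" by (intro Max_in) auto
  then obtain j where "j \<in> -{i}" "?b j = Max (?b ` (-{i}))" by (metis imageE)
  then have j: "j \<in> -{i}" "\<And>k. k \<noteq> i \<Longrightarrow> ?b k \<le> ?b j" by simp_all
  have "?b j > 0"
  proof (rule ccontr)
    assume "\<not> ?b j > 0"
    then have "(\<Sum>k\<in>-{i}. ?b k) = 0" using j(2) by (intro sum.neutral) fastforce
    then show False using pos by simp
  qed
  then have "?b i > 0" using i[of j] by simp
  define b' where "b' = b - (Poly_Mapping.single i 1 + Poly_Mapping.single j 1)"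
  have b: "b = b' + (Poly_Mapping.single i 1 + Poly_Mapping.single j 1)"
    using \<open>?b i > 0\<close> \<open>?b j > 0\<close> j(1)
    by (intro poly_mapping_eqI) (auto simp: b'_def lookup_add lookup_minus lookup_single when_def)
  have "(\<Sum>k\<in>UNIV. Poly_Mapping.lookup b' k) = 2 * q"
    using total sum_lookup_edge[of i j] unfolding b lookup_add[of b'] sum.distrib by simp
  moreover have "Poly_Mapping.lookup b' k \<le> q" for k
  proof (rule ccontr)
    \<comment> \<open>An entry still exceeding \<open>q\<close> would be a third entry equal to
      \<open>Suc q\<close>. The two chosen entries are at least as large, so the total would be at
      least \<open>3 * Suc q\<close>.\<close>
    assume k: "\<not> Poly_Mapping.lookup b' k \<le> q"
    then have "?b k = Suc q" "k \<noteq> i" "k \<noteq> j"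
      using le[of k] j(1) unfolding b by (auto simp: lookup_add lookup_single when_def split: if_splits)
    then have "?b i + ?b j + ?b k \<ge> 3 * Suc q"
      using i[of k] j(2)[of k] by simp
    moreover have "sum ?b {i, j, k} \<le> sum ?b UNIV" by (intro sum_mono2) auto
    ultimately show False using total j(1) \<open>k \<noteq> i\<close> \<open>k \<noteq> j\<close> by auto
  qed
  ultimately have "b' \<in> edge_sums q" by (simp add: edge_sums_def)
  then show thesis using b j(1) by (intro that[of i j b']) auto
qed

text \<open>Each edge adds 2 to the degree and at most 1 to every exponent. The converse peels off
  one edge at a time.\<close>

lemma sums_of_edge_monomials:
  "{\<Sum>j<q. e j | e. \<forall>j<q. e j \<in> edge_monomials} = (edge_sums q :: ('n::finite \<Rightarrow>\<^sub>0 nat) set)"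
proof (intro equalityI subsetI)
  fix b :: "'n \<Rightarrow>\<^sub>0 nat" assume "b \<in> {\<Sum>j<q. e j | e. \<forall>j<q. e j \<in> edge_monomials}"
  then obtain e where b: "b = (\<Sum>j<q. e j)" and e: "\<And>j. j < q \<Longrightarrow> e j \<in> edge_monomials" by blast
  have "(\<Sum>i\<in>UNIV. Poly_Mapping.lookup (e j) i) = 2" if "j < q" for j
    using e[OF that] sum_lookup_edge unfolding edge_monomials_def by auto
  then have "(\<Sum>j<q. \<Sum>i\<in>UNIV. Poly_Mapping.lookup (e j) i) = 2 * q" by simp
  moreover have "Poly_Mapping.lookup (e j) i \<le> 1" if "j < q" for i j
    using e[OF that] by (auto simp: edge_monomials_def lookup_add lookup_single when_def)
  then have "(\<Sum>j<q. Poly_Mapping.lookup (e j) i) \<le> (\<Sum>j<q. 1)" for i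
    by (intro sum_mono) simp
  ultimately show "b \<in> edge_sums q"
    by (simp add: b edge_sums_def lookup_sum sum.swap[of _ "{..<q}"])
next
  show "b \<in> {\<Sum>j<q. e j | e. \<forall>j<q. e j \<in> edge_monomials}" if "b \<in> edge_sums q" for b :: "'n \<Rightarrow>\<^sub>0 nat"
    using that
  proof (induction q arbitrary: b)
    case 0
    then have "b = 0" by (intro poly_mapping_eqI) (simp add: edge_sums_def)
    then show ?case by simp
  next
    case (Suc q)
    from Suc.prems obtain i j b' where ij: "i \<noteq> j" and b': "b' \<in> edge_sums q"
      and b: "b = b' + (Poly_Mapping.single i 1 + Poly_Mapping.single j 1)"
      by (rule edge_sums_Suc_decompose)
    from Suc.IH[OF b'] obtain e where e: "b' = (\<Sum>j<q. e j)" "\<forall>j<q. e j \<in> edge_monomials" by blast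
    let ?e = "e(q := Poly_Mapping.single i 1 + Poly_Mapping.single j 1)"
    have "b = (\<Sum>j<Suc q. ?e j)" by (simp add: b e(1))
    moreover have "\<forall>j<Suc q. ?e j \<in> edge_monomials"
      using e(2) ij by (auto simp: edge_monomials_def less_Suc_eq)
    ultimately show ?case by blast
  qed
qed

text \<open>Both vectors have the same coordinate sum, so no coordinate can be strictly
  smaller.\<close>

lemma edge_sums_antichain:
  assumes "a \<in> edge_sums q" "b \<in> edge_sums q" "a \<preceq> b"
  shows "a = b"
proof -
  have "Poly_Mapping.lookup a i = Poly_Mapping.lookup b i" for i
    using assms by (intro sum_mono_inv[of "Poly_Mapping.lookup a" UNIV "Poly_Mapping.lookup b"])
      (auto simp: edge_sums_def mono_le_def)
  then show ?thesis by (intro poly_mapping_eqI)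
qed

section \<open>Divisors of the minimal generators\<close>

text \<open>By hypothesis \<open>q\<close> is the largest number of edges whose product respects
  \<open>c\<close>, so it is the value of \<open>delta\<close>. The bounded elements of
  \<open>edge_sums q\<close> form an antichain, hence are the exponents of the minimal
  generators.\<close>

lemma D_set_complete_graph:
  fixes K :: "'k::field itself" and c :: "'n::finite \<Rightarrow> nat"
  assumes "1 \<le> q" and b0: "b0 \<in> edge_sums q" "\<And>i. Poly_Mapping.lookup b0 i \<le> c i"
    and max: "\<And>p b. b \<in> edge_sums p \<Longrightarrow> (\<And>i. Poly_Mapping.lookup b i \<le> c i) \<Longrightarrow> p \<le> q"
  shows "D_set K complete_graph c =
    {a. \<exists>b\<in>edge_sums q. (\<forall>i. Poly_Mapping.lookup b i \<le> c i) \<and> a \<preceq> b}"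
proof -
  define A :: "nat \<Rightarrow> ('n \<Rightarrow>\<^sub>0 nat) set" where
    "A p = {b. (\<exists>a\<in>edge_sums p. a \<preceq> b) \<and> (\<forall>i. Poly_Mapping.lookup b i \<le> c i)}" for p
  define M :: "('n \<Rightarrow>\<^sub>0 nat) set" where
    "M = {b \<in> edge_sums q. \<forall>i. Poly_Mapping.lookup b i \<le> c i}"
  have bp: "bounded_part c (ideal_power (edge_ideal complete_graph) p) =
      (ideal_gen (mono_of ` A p) :: ('n, 'k) mpoly set)" for p
    unfolding edge_ideal_complete_graph ideal_power_monomials sums_of_edge_monomials
      bounded_part_monomials A_def ..
  have "A p \<noteq> {} \<Longrightarrow> p \<le> q" for p
  proof -
    assume "A p \<noteq> {}"
    then obtain a b where "a \<in> edge_sums p" "a \<preceq> b" "\<And>i. Poly_Mapping.lookup b i \<le> c i"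
      unfolding A_def by blast
    then show "p \<le> q"
      using max[of a p] unfolding mono_le_def by (meson order_trans)
  qed
  moreover have "A q \<noteq> {}"
    using b0 mono_le_refl unfolding A_def by blast
  ultimately have "delta c (edge_ideal complete_graph :: ('n, 'k) mpoly set) = q"
    unfolding delta_def bp ideal_gen_monomials_eq_0_iff using \<open>1 \<le> q\<close>
    by (intro Greatest_equality) auto
  then have "base_set complete_graph c = (mono_of ` M :: ('n, 'k) mpoly set)"
    unfolding base_set_def bp
  proof (simp, intro min_mono_gens_monomials)
    show "a = b" if "a \<in> M" "b \<in> M" "a \<preceq> b" for a b
      using that edge_sums_antichain by (auto simp: M_def)
    show "M \<subseteq> A q" by (auto simp: M_def A_def intro: mono_le_Bex)
    show "\<exists>m\<in>M. m \<preceq> a" if "a \<in> A q" for a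
    proof -
      from that obtain b where "b \<in> edge_sums q" "b \<preceq> a" "\<And>i. Poly_Mapping.lookup a i \<le> c i"
        unfolding A_def by blast
      \<comment> \<open>A vector below a bounded one is itself bounded.\<close>
      moreover from this have "b \<in> M"
        unfolding M_def mono_le_def by (auto intro: order_trans)
      ultimately show ?thesis by blast
    qed
  qed
  then show ?thesis
    by (auto simp: D_set_def M_def mono_of_dvd_iff)
qed

text \<open>With \<open>r = f m\<close> this splits off the summand at \<open>m\<close>.\<close>

lemma sum_fun_upd:
  fixes f :: "'n::finite \<Rightarrow> nat"
  shows "(\<Sum>i\<in>UNIV. (f(m := r)) i) = r + (\<Sum>i\<in>-{m}. f i)"
proof -
  have "(\<Sum>i\<in>UNIV. (f(m := r)) i) = (f(m := r)) m + (\<Sum>i\<in>-{m}. (f(m := r)) i)"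
    by (simp add: sum.remove[of UNIV m] Compl_eq_Diff_UNIV)
  also have "(\<Sum>i\<in>-{m}. (f(m := r)) i) = (\<Sum>i\<in>-{m}. f i)"
    by (intro sum.cong) auto
  finally show ?thesis by simp
qed

text \<open>For an even total \<open>c\<close> itself serves as \<open>b\<close>. For an odd total
  \<open>a\<close> must be smaller than \<open>c\<close> at some \<open>m\<close>, and lowering
  \<open>c\<close> by 1 there keeps it above \<open>a\<close> and makes the total even. Balancedness
  keeps every entry at most half the total, rounded down.\<close>

lemma balanced_extension:
  fixes c :: "'n::finite \<Rightarrow> nat"
  assumes pos: "\<And>i. c i > 0" and balanced: "\<And>i. 2 * c i \<le> sum c UNIV"
    and a: "\<And>i. Poly_Mapping.lookup a i \<le> c i"
      "(\<Sum>i\<in>UNIV. Poly_Mapping.lookup a i) \<le> 2 * (sum c UNIV div 2)"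
  shows "\<exists>b\<in>edge_sums (sum c UNIV div 2). (\<forall>i. Poly_Mapping.lookup b i \<le> c i) \<and> a \<preceq> b"
proof (cases "even (sum c UNIV)")
  case True
  have "c i \<le> sum c UNIV div 2" for i using balanced[of i] by simp
  then show ?thesis
    using True a(1) by (intro bexI[of _ "Abs_poly_mapping c"]) (auto simp: edge_sums_def mono_le_def)
next
  case False
  have "\<exists>m. Poly_Mapping.lookup a m < c m"
  proof (rule ccontr)
    assume "\<nexists>m. Poly_Mapping.lookup a m < c m"
    then have "Poly_Mapping.lookup a = c" using a(1) by (intro ext) (metis le_neq_implies_less)
    then show False using a(2) False by (auto elim: oddE)
  qed
  then obtain m where m: "Poly_Mapping.lookup a m < c m" ..
  let ?b = "c(m := c m - 1)"
  have "sum c UNIV = c m + (\<Sum>i\<in>-{m}. c i)"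
    using sum_fun_upd[of c m "c m"] by simp
  then have "sum ?b UNIV = 2 * (sum c UNIV div 2)"
    using sum_fun_upd[of c m "c m - 1"] pos[of m] False by (auto elim!: oddE)
  moreover have "?b i \<le> sum c UNIV div 2" for i
    using balanced[of i] by auto
  ultimately show ?thesis
    using m a(1) by (intro bexI[of _ "Abs_poly_mapping ?b"]) (auto simp: edge_sums_def mono_le_def)
qed

text \<open>Here \<open>delta\<close> is half the total, rounded down: a product of \<open>p\<close>
  edges has degree \<open>2 * p\<close>, at most the total of \<open>c\<close>, and
  \<open>balanced_extension\<close> attains the bound.\<close>

lemma D_set_balanced:
  fixes c :: "'n::finite \<Rightarrow> nat"
  assumes pos: "\<And>i. c i > 0" and balanced: "\<And>i. 2 * c i \<le> sum c UNIV"
  shows "D_set K complete_graph c = {a. (\<forall>i. Poly_Mapping.lookup a i \<le> c i) \<and>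
    (\<Sum>i\<in>UNIV. Poly_Mapping.lookup a i) \<le> 2 * (sum c UNIV div 2)}"
proof -
  let ?q = "sum c UNIV div 2"
  have "1 \<le> ?q"
    using pos[of undefined] balanced[of undefined] by linarith
  moreover obtain b0 where "b0 \<in> edge_sums ?q" "\<And>i. Poly_Mapping.lookup b0 i \<le> c i"
    using balanced_extension[OF pos balanced, of 0] by auto
  moreover have "p \<le> ?q" if "b \<in> edge_sums p" "\<And>i. Poly_Mapping.lookup b i \<le> c i" for p b
  proof -
    have "2 * p \<le> sum c UNIV"
      using sum_mono[of UNIV "Poly_Mapping.lookup b" c] that by (simp add: edge_sums_def)
    then show ?thesis by simp
  qed
  ultimately have "D_set K complete_graph c =
      {a. \<exists>b\<in>edge_sums ?q. (\<forall>i. Poly_Mapping.lookup b i \<le> c i) \<and> a \<preceq> b}"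
    by (rule D_set_complete_graph)
  also have "\<dots> = {a. (\<forall>i. Poly_Mapping.lookup a i \<le> c i) \<and>
      (\<Sum>i\<in>UNIV. Poly_Mapping.lookup a i) \<le> 2 * ?q}"
  proof (intro Collect_cong iffI conjI)
    fix a
    assume "\<exists>b\<in>edge_sums ?q. (\<forall>i. Poly_Mapping.lookup b i \<le> c i) \<and> a \<preceq> b"
    then obtain b where b: "b \<in> edge_sums ?q" "\<And>i. Poly_Mapping.lookup b i \<le> c i" "a \<preceq> b" by blast
    show "\<forall>i. Poly_Mapping.lookup a i \<le> c i"
      using b(2,3) unfolding mono_le_def by (meson order_trans)
    show "(\<Sum>i\<in>UNIV. Poly_Mapping.lookup a i) \<le> 2 * ?q"
      using sum_mono[of UNIV "Poly_Mapping.lookup a" "Poly_Mapping.lookup b"] b(1,3)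
      by (simp add: edge_sums_def mono_le_def)
  qed (use balanced_extension[OF pos balanced] in blast)
  finally show ?thesis .
qed

section \<open>Reduction of a dominant bound\<close>

lemma ex_neq_of_card: "CARD('n::finite) \<ge> 2 \<Longrightarrow> \<exists>j. j \<noteq> (m :: 'n)"
proof (rule ccontr)
  assume "CARD('n) \<ge> 2" "\<nexists>j. j \<noteq> m"
  then have "(UNIV :: 'n set) = {m}" by auto
  then have "CARD('n) = 1" unfolding One_nat_def card_1_singleton_iff by blast
  then show False using \<open>CARD('n) \<ge> 2\<close> by linarith
qed

lemma sum_others_pos:
  fixes c :: "'n::finite \<Rightarrow> nat"
  assumes "CARD('n) \<ge> 2" "\<And>i. c i > 0"
  shows "(\<Sum>i\<in>-{m}. c i) > 0"
  using ex_neq_of_card[OF assms(1), where m = m] assms(2) by (intro sum_pos) auto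

text \<open>Let \<open>r\<close> be the sum of the other bounds. A bounded product of
  \<open>p\<close> edges has exponent at most \<open>p\<close> at \<open>m\<close> and total at most
  \<open>r\<close> elsewhere, so \<open>2 * p \<le> p + r\<close>. Thus \<open>delta\<close> is
  \<open>r\<close> for both bounds, and at \<open>p = r\<close> the exponent at \<open>m\<close> is
  at most \<open>r\<close> anyway.\<close>

lemma D_set_unbalanced:
  fixes c :: "'n::finite \<Rightarrow> nat"
  assumes card: "CARD('n) \<ge> 2" and pos: "\<And>i. c i > 0" and m: "(\<Sum>i\<in>-{m}. c i) < c m"
  shows "D_set K complete_graph c = D_set K complete_graph (c(m := \<Sum>i\<in>-{m}. c i))"
proof -
  let ?r = "\<Sum>i\<in>-{m}. c i"
  let ?u = "c(m := ?r)"
  have le: "c i \<le> ?r" if "i \<noteq> m" for i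
    using that by (intro member_le_sum) auto
  have r: "1 \<le> ?r" using sum_others_pos[of c m, OF card pos] by simp
  have sum_u: "sum ?u UNIV = 2 * ?r" by (simp only: sum_fun_upd)
  have p_le: "p \<le> ?r" if b: "b \<in> edge_sums p" "\<And>i. Poly_Mapping.lookup b i \<le> c i" for p b
  proof -
    have "2 * p = Poly_Mapping.lookup b m + (\<Sum>i\<in>-{m}. Poly_Mapping.lookup b i)"
      using b(1) sum_fun_upd[of "Poly_Mapping.lookup b" m "Poly_Mapping.lookup b m"]
      by (simp add: edge_sums_def)
    moreover have "(\<Sum>i\<in>-{m}. Poly_Mapping.lookup b i) \<le> ?r" using b(2) by (intro sum_mono)
    moreover have "Poly_Mapping.lookup b m \<le> p" using b(1) by (simp add: edge_sums_def)
    ultimately show ?thesis by linarith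
  qed
  \<comment> \<open>The lowered bound is itself an edge sum, which shows that \<open>?r\<close>
    edges are attained under both bounds.\<close>
  have u: "Abs_poly_mapping ?u \<in> edge_sums ?r" "\<And>i. Poly_Mapping.lookup (Abs_poly_mapping ?u) i \<le> ?u i"
    using sum_u le by (auto simp: edge_sums_def)
  have u_le: "?u i \<le> c i" for i using m by simp
  have p_le_u: "p \<le> ?r" if "b \<in> edge_sums p" "\<And>i. Poly_Mapping.lookup b i \<le> ?u i" for p b
    using that(1)
  proof (rule p_le)
    show "Poly_Mapping.lookup b i \<le> c i" for i using that(2) u_le by (rule order_trans)
  qed
  have "D_set K complete_graph c =
      {a. \<exists>b\<in>edge_sums ?r. (\<forall>i. Poly_Mapping.lookup b i \<le> c i) \<and> a \<preceq> b}"
    using r u u_le p_le by (intro D_set_complete_graph[where ?b0.0 = "Abs_poly_mapping ?u"]) (auto intro: order_trans)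
  also have "\<dots> = {a. \<exists>b\<in>edge_sums ?r. (\<forall>i. Poly_Mapping.lookup b i \<le> ?u i) \<and> a \<preceq> b}"
  proof -
    have "(\<forall>i. Poly_Mapping.lookup b i \<le> c i) \<longleftrightarrow> (\<forall>i. Poly_Mapping.lookup b i \<le> ?u i)"
      if "b \<in> edge_sums ?r" for b
      using that m unfolding edge_sums_def by (auto split: if_splits) (metis le_trans less_imp_le)
    then show ?thesis by blast
  qed
  also have "\<dots> = D_set K complete_graph ?u"
  proof (rule D_set_complete_graph[symmetric])
    show "p \<le> ?r" if "b \<in> edge_sums p" "\<And>i. Poly_Mapping.lookup b i \<le> ?u i" for p b
      using that by (rule p_le_u)
  qed (fact r u)+
  finally show ?thesis .
qed

text \<open>If some bound exceeds half the total, lowering it to the sum of the others makes it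
  exactly half of the new total, and no other bound exceeds that half.\<close>

lemma D_set_complete_graph_box:
  fixes c :: "'n::finite \<Rightarrow> nat"
  assumes card: "CARD('n) \<ge> 2" and pos: "\<And>i. c i > 0"
  obtains u :: "'n \<Rightarrow> nat" where "\<And>i. u i > 0" "\<And>i. 2 * u i \<le> sum u UNIV"
    "D_set K complete_graph c = {a. (\<forall>i. Poly_Mapping.lookup a i \<le> u i) \<and>
       (\<Sum>i\<in>UNIV. Poly_Mapping.lookup a i) \<le> 2 * (sum u UNIV div 2)}"
proof (cases "\<forall>i. 2 * c i \<le> sum c UNIV")
  case True
  then show thesis using that[of c, OF pos] D_set_balanced[of c K, OF pos] by blast
next
  case False
  then obtain m where "sum c UNIV < 2 * c m" by (meson not_le)
  then have m: "(\<Sum>i\<in>-{m}. c i) < c m"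
    using sum_fun_upd[of c m "c m"] by simp
  let ?r = "\<Sum>i\<in>-{m}. c i"
  let ?u = "c(m := ?r)"
  have le: "c i \<le> ?r" if "i \<noteq> m" for i
    using that by (intro member_le_sum) auto
  have "0 < ?r" using card pos by (rule sum_others_pos)
  then have u_pos: "?u i > 0" for i using pos by simp
  have "sum ?u UNIV = 2 * ?r" by (simp only: sum_fun_upd)
  then have bal: "2 * ?u i \<le> sum ?u UNIV" for i using le by simp
  show thesis
    using D_set_balanced[of ?u K, OF u_pos bal] D_set_unbalanced[where K = K, OF card pos m]
    by (intro that[of ?u, OF u_pos bal]) simp
qed

section \<open>The classification\<close>

lemma conv_D_balanced:
  fixes c :: "'n::finite \<Rightarrow> nat"
  assumes "\<And>i. c i > 0" "\<And>i. 2 * c i \<le> sum c UNIV"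
  shows "conv_D K complete_graph c = trunc_box c (2 * (sum c UNIV div 2))"
  unfolding conv_D_def D_set_balanced[OF assms] convex_hull_real_vec_eq_trunc_box ..

lemma conv_D_complete_graph:
  fixes c :: "'n::finite \<Rightarrow> nat"
  assumes "CARD('n) \<ge> 2" "\<And>i. c i > 0"
  obtains u :: "'n \<Rightarrow> nat" where "\<And>i. u i > 0" "\<And>i. 2 * u i \<le> sum u UNIV"
    "conv_D K complete_graph c = trunc_box u (2 * (sum u UNIV div 2))"
proof -
  obtain u :: "'n \<Rightarrow> nat" where u: "\<And>i. u i > 0" "\<And>i. 2 * u i \<le> sum u UNIV"
    and D: "D_set K complete_graph c = {a. (\<forall>i. Poly_Mapping.lookup a i \<le> u i) \<and>
       (\<Sum>i\<in>UNIV. Poly_Mapping.lookup a i) \<le> 2 * (sum u UNIV div 2)}"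
    using assms by (rule D_set_complete_graph_box[of c K]) blast
  have "conv_D K complete_graph c = trunc_box u (2 * (sum u UNIV div 2))"
    unfolding conv_D_def D convex_hull_real_vec_eq_trunc_box ..
  with u show thesis by (rule that)
qed

theorem theorem4p5:
  fixes K :: "'k::field itself"
  assumes "CARD('n::finite) \<ge> 3"
  shows "{P :: (real ^ 'n) set.
            gorenstein_polytope P \<and>
            (\<exists>c :: 'n \<Rightarrow> nat. (\<forall>i. c i > 0) \<and> P = conv_D K complete_graph c)} =
         {(\<lambda>x. x + 1) ` cube_Q'}
         \<union> (if even CARD('n) then {cube_Q} else {})
         \<union> (if CARD('n) = 3 then {P3} else {})"
  (is "?L = ?R")
proof (intro equalityI subsetI)
  fix P :: "(real ^ 'n) set" assume "P \<in> ?L"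
  then obtain c :: "'n \<Rightarrow> nat" where gor: "gorenstein_polytope P" and c: "\<And>i. c i > 0"
    and P: "P = conv_D K complete_graph c" by blast
  have "CARD('n) \<ge> 2" using assms by simp
  then obtain u :: "'n \<Rightarrow> nat" where u: "\<And>i. u i > 0" "\<And>i. 2 * u i \<le> sum u UNIV"
    and "conv_D K complete_graph c = trunc_box u (2 * (sum u UNIV div 2))"
    using c by (rule conv_D_complete_graph[of c K]) blast
  then have P': "P = trunc_box u (2 * (sum u UNIV div 2))"
    using P by simp
  consider "u = (\<lambda>i. 2)" | "u = (\<lambda>i. 1)" "even CARD('n)" | "u = (\<lambda>i. 1)" "CARD('n) = 3"
    using gorenstein_balanced_cases[OF assms u] gor unfolding P' by blast
  then show "P \<in> ?R"
  proof cases
    case 1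
    then show ?thesis unfolding P' translated_cube_eq_trunc_box by simp
  next
    case 2
    then show ?thesis unfolding P' cube_eq_trunc_box by simp
  next
    case 3
    then show ?thesis unfolding P' P3_eq_trunc_box by simp
  qed
next
  fix P :: "(real ^ 'n) set" assume "P \<in> ?R"
  then consider "P = trunc_box (\<lambda>i. 2) (2 * CARD('n))"
    | "P = trunc_box (\<lambda>i. 1) CARD('n)" "even CARD('n)"
    | "P = trunc_box (\<lambda>i. 1) 2" "CARD('n) = 3"
    unfolding translated_cube_eq_trunc_box cube_eq_trunc_box P3_eq_trunc_box
    by (auto split: if_splits)
  then show "P \<in> ?L"
  proof cases
    case 1
    \<comment> \<open>With \<open>d = 1\<close> the translated box is already
      \<open>[-1,1]^n\<close>, and \<open>d * s = 2 * n\<close> makes the cut vacuous.\<close>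
    have "gorenstein_polytope P" unfolding 1 by (rule gorenstein_trunc_boxI[of 1]) auto
    moreover have "P = conv_D K complete_graph (\<lambda>i. 2)"
      unfolding 1 using assms by (subst conv_D_balanced) auto
    ultimately show ?thesis by (auto intro!: exI[of _ "\<lambda>i. 2"])
  next
    case 2
    \<comment> \<open>With \<open>d = 2\<close> and \<open>s = n\<close> again
      \<open>d * s = 2 * n\<close>.\<close>
    have "gorenstein_polytope P" unfolding 2(1) by (rule gorenstein_trunc_boxI[of 2]) auto
    moreover have "P = conv_D K complete_graph (\<lambda>i. 1)"
      unfolding 2(1) using assms 2(2) by (subst conv_D_balanced) auto
    ultimately show ?thesis by (auto intro!: exI[of _ "\<lambda>i. 1"])
  next
    case 3
    \<comment> \<open>Here \<open>d * s = 4 = n + 1\<close>, so the cut is a genuine facet at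
      distance 1.\<close>
    have "gorenstein_polytope P" unfolding 3(1) using 3(2) by (intro gorenstein_trunc_boxI[of 2]) auto
    \<comment> \<open>The total 3 is rounded down to 2, which produces the cut.\<close>
    moreover have "P = conv_D K complete_graph (\<lambda>i. 1)"
      unfolding 3(1) using 3(2) by (subst conv_D_balanced) auto
    ultimately show ?thesis by (auto intro!: exI[of _ "\<lambda>i. 1"])
  qed
qed

end
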